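(* Let $m_1,\dots,m_k,n_1,\dots,n_r$ be positive integers and $\mathcal{R}=\{(t_1,\dots,t_k,s_1,\dots,s_r)\in\mathbb{R}_{\ge0}^{k+r}:\sum_{i=1}^km_it_i=\sum_{j=1}^rn_js_j\}$. Let $(Y,\nu)$ be a probability space and $F:Y\times\mathbb{R}_{\ge0}^{k+r}\to\mathbb{R}$ a bounded measurable function. Suppose there exist $\delta>0$ and $C>0$ such that for all $h_1,h_2\in\mathcal{R}$, $$\Big|\int_YF(x,h_1)F(x,h_2)\,d\nu(x)\Big|\le Ce^{-\delta\min\{\lfloor h_1\rfloor,\lfloor h_2\rfloor,\|h_1-h_2\|_\infty\}}.$$ Then, given $\epsilon>0$, for $\nu$-almost every $y\in Y$, $$\frac{1}{T^{k+r-1}}\int_{J^T}F(y,h)\,dh=\begin{cases}o\big(T^{-1}(\log T)^{\frac32+r+\epsilon}\big),& r+k>2,\\ o\big(T^{-1/2}(\log T)^{\frac32+\epsilon}\big),&r+k=2,\end{cases}$$ as $T\to\infty$, where $J^T=\{(t_1,\dots,t_k,s_1,\dots,s_r)\in\mathcal{R}:s_i\le T\ \forall i\}$.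
   Context: For $h=(h_1,\dots,h_{k+r})\in\mathbb{R}^{k+r}$, $\lfloor h\rfloor=\min\{|h_1|,\dots,|h_{k+r}|\}$. The integral $dh$ over $J^T\subset\mathcal{R}$ is with respect to the $(k+r-1)$-dimensional Lebesgue measure on the hyperplane containing $\mathcal{R}$. *)

theory Defs
  imports "HOL-Probability.Probability_Measure" "HOL-Library.Landau_Symbols"
begin

text \<open>Points of R^(k+r) are represented as extensional functions on {..<k+r}:
  t_(i+1) = h i for i < k and s_(j+1) = h (k+j) for j < r.
  The weights are m i (i < k) and n j (j < r).\<close>

definition orth :: "nat \<Rightarrow> (nat \<Rightarrow> real) set" where
  "orth d = PiE {..<d} (\<lambda>_. {0..})"

definition hypR :: "nat \<Rightarrow> nat \<Rightarrow> (nat \<Rightarrow> nat) \<Rightarrow> (nat \<Rightarrow> nat) \<Rightarrow> (nat \<Rightarrow> real) set" where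
  "hypR k r m n = {h \<in> orth (k + r).
      (\<Sum>i<k. real (m i) * h i) = (\<Sum>j<r. real (n j) * h (k + j))}"

definition JT :: "nat \<Rightarrow> nat \<Rightarrow> (nat \<Rightarrow> nat) \<Rightarrow> (nat \<Rightarrow> nat) \<Rightarrow> real \<Rightarrow> (nat \<Rightarrow> real) set" where
  "JT k r m n T = {h \<in> hypR k r m n. \<forall>j<r. h (k + j) \<le> T}"

definition minabs :: "nat \<Rightarrow> (nat \<Rightarrow> real) \<Rightarrow> real" where
  "minabs d h = Min ((\<lambda>i. \<bar>h i\<bar>) ` {..<d})"

definition supdist :: "nat \<Rightarrow> (nat \<Rightarrow> real) \<Rightarrow> (nat \<Rightarrow> real) \<Rightarrow> real" where
  "supdist d h1 h2 = Max ((\<lambda>i. \<bar>h1 i - h2 i\<bar>) ` {..<d})"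

text \<open>Parametrisation of the hyperplane by its first k+r-1 coordinates; the last
  coordinate s_r is solved from the defining equation.\<close>
definition lastcoord :: "nat \<Rightarrow> nat \<Rightarrow> (nat \<Rightarrow> nat) \<Rightarrow> (nat \<Rightarrow> nat) \<Rightarrow> (nat \<Rightarrow> real) \<Rightarrow> real" where
  "lastcoord k r m n g =
     ((\<Sum>i<k. real (m i) * g i) - (\<Sum>j<r - 1. real (n j) * g (k + j))) / real (n (r - 1))"

definition lift :: "nat \<Rightarrow> nat \<Rightarrow> (nat \<Rightarrow> nat) \<Rightarrow> (nat \<Rightarrow> nat) \<Rightarrow> (nat \<Rightarrow> real) \<Rightarrow> (nat \<Rightarrow> real)" where
  "lift k r m n g = (\<lambda>i. if i < k + r - 1 then g i
                          else if i = k + r - 1 then lastcoord k r m n g else undefined)"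

text \<open>Jacobian factor: (k+r-1)-dimensional Lebesgue (surface) measure on the hyperplane
  equals |normal| / |last normal component| times the pushforward of Lebesgue measure
  on R^(k+r-1) under the parametrisation.\<close>
definition hyp_factor :: "nat \<Rightarrow> nat \<Rightarrow> (nat \<Rightarrow> nat) \<Rightarrow> (nat \<Rightarrow> nat) \<Rightarrow> real" where
  "hyp_factor k r m n =
     sqrt ((\<Sum>i<k. (real (m i))\<^sup>2) + (\<Sum>j<r. (real (n j))\<^sup>2)) / real (n (r - 1))"

definition hyp_integral ::
  "nat \<Rightarrow> nat \<Rightarrow> (nat \<Rightarrow> nat) \<Rightarrow> (nat \<Rightarrow> nat) \<Rightarrow> real \<Rightarrow> ((nat \<Rightarrow> real) \<Rightarrow> real) \<Rightarrow> real" where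
  "hyp_integral k r m n T f =
     hyp_factor k r m n *
     integral\<^sup>L (PiM {..<k + r - 1} (\<lambda>_. lborel))
       (\<lambda>g. indicator {g. lift k r m n g \<in> JT k r m n T} g * f (lift k r m n g))"

end

theory Submission
  imports Defs "HOL-Real_Asymp.Real_Asymp"
begin

text \<open>
  Put \<open>d = k + r - 1\<close> and take \<open>T\<close> between \<open>2 ^ (N - 1)\<close> and \<open>2 ^ N\<close>. The points of \<open>J\<^sup>T\<close> having a
  coordinate below \<open>\<beta> * N\<close> fill a volume \<open>O(T ^ (d - 1) * ln T)\<close>, so the boundedness of \<open>F\<close> suffices
  there. On any subset \<open>D\<close> of the remaining bulk the decay hypothesis bounds the second moment of the
  integral over \<open>D\<close> by a constant times the volume of \<open>D\<close>. As these bounds add up over disjoint sets,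
  dyadic chaining in \<open>T\<close> (the Rademacher--Menshov argument) controls the expected square of the maximum
  over all integers \<open>T \<le> 2 ^ N\<close> by \<open>N\<^sup>2 * 2 ^ (d * N)\<close>; summing over \<open>N\<close> gives, almost surely, the bound
  \<open>T powr (d / 2) * ln T powr (3 / 2 + \<epsilon>)\<close> for integers \<open>T\<close>. Passing from \<open>\<lfloor>T\<rfloor>\<close> to \<open>T\<close> costs only
  \<open>O(T ^ (d - 1))\<close>.
\<close>

section \<open>Chaining for bounded random fields\<close>

text \<open>Binary expansion of \<open>j\<close>, by induction on \<open>N\<close>: rounding
  \<open>j\<close> down to the even index \<open>2 * (j div 2)\<close> costs at most one increment
  of step 1, and the rest is the same claim at half the resolution. Replacing the one increment used
  on a level by the root of the sum of squares over the whole level makes the right side independent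
  of \<open>j\<close>, so that it controls a maximum.\<close>

lemma dyadic_chaining:
  fixes f :: "nat \<Rightarrow> real"
  assumes "j \<le> 2 ^ N"
  shows "\<bar>f j - f 0\<bar> \<le> (\<Sum>l\<le>N. sqrt (\<Sum>i<2 ^ (N - l). (f (Suc i * 2 ^ l) - f (i * 2 ^ l))\<^sup>2))"
  using assms
proof (induction N arbitrary: f j)
  case 0
  then consider "j = 0" | "j = 1" by force
  then show ?case by cases auto
next
  case (Suc N)
  define i where "i = j div 2"
  let ?V = "\<lambda>l. sqrt (\<Sum>i<2 ^ (Suc N - l). (f (Suc i * 2 ^ l) - f (i * 2 ^ l))\<^sup>2)"
  have i: "i \<le> 2 ^ N" using Suc.prems by (auto simp: i_def)
  \<comment> \<open>The induction hypothesis is applied to \<open>f\<close> along even indices; its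
    level \<open>l\<close> is level \<open>Suc l\<close> of \<open>f\<close>.\<close>
  have IH: "\<bar>f (2 * i) - f 0\<bar> \<le> (\<Sum>l\<le>N. ?V (Suc l))"
    using Suc.IH[OF i, of "\<lambda>i. f (2 * i)"] by (simp add: mult_ac algebra_simps)
  have last: "\<bar>f j - f (2 * i)\<bar> \<le> ?V 0"
  proof (cases "even j")
    case True
    then show ?thesis by (auto simp: i_def intro!: sum_nonneg)
  next
    case False
    then have j: "j = Suc (2 * i)" by (auto simp: i_def elim: oddE)
    have "2 * i < 2 ^ Suc N" using Suc.prems j by simp
    then have "(f (Suc (2 * i)) - f (2 * i))\<^sup>2 \<le> (\<Sum>i<2 ^ Suc N. (f (Suc i) - f i)\<^sup>2)"
      by (intro member_le_sum) auto
    then have "sqrt ((f j - f (2 * i))\<^sup>2) \<le> ?V 0"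
      unfolding real_sqrt_le_iff j by simp
    then show ?thesis by simp
  qed
  have "\<bar>f j - f 0\<bar> \<le> ?V 0 + (\<Sum>l\<le>N. ?V (Suc l))"
    using IH last by linarith
  then show ?case by (simp only: sum.atMost_Suc_shift)
qed

text \<open>Cauchy--Schwarz over the \<open>N + 1\<close> levels, at the price of a factor
  \<open>real N + 1\<close>; in this form the right side can be integrated term by term.\<close>

lemma dyadic_chaining_square:
  fixes f :: "nat \<Rightarrow> real"
  assumes "j \<le> 2 ^ N"
  shows "(f j - f 0)\<^sup>2
    \<le> (real N + 1) * (\<Sum>l\<le>N. \<Sum>i<2 ^ (N - l). (f (Suc i * 2 ^ l) - f (i * 2 ^ l))\<^sup>2)"
proof -
  let ?V = "\<lambda>l. \<Sum>i<2 ^ (N - l). (f (Suc i * 2 ^ l) - f (i * 2 ^ l))\<^sup>2"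
  have "(f j - f 0)\<^sup>2 \<le> (\<Sum>l\<le>N. sqrt (?V l))\<^sup>2"
    using power_mono[OF dyadic_chaining[OF assms, of f], of 2] by simp
  also have "\<dots> \<le> (\<Sum>l\<le>N. (sqrt (?V l))\<^sup>2) * (\<Sum>l\<le>N. 1\<^sup>2)"
    using Cauchy_Schwarz_ineq_sum[of "\<lambda>l. sqrt (?V l)" "\<lambda>_. 1" "{..N}"] by simp
  also have "\<dots> = (real N + 1) * (\<Sum>l\<le>N. ?V l)"
    by (simp add: sum_nonneg mult.commute)
  finally show ?thesis .
qed

section \<open>Integrals of a bounded random field over sets of finite measure\<close>

locale bounded_random_field = prob_space M + L: sigma_finite_measure L
  for M :: "'a measure" and L :: "'b measure" +
  fixes G :: "'a \<Rightarrow> 'b \<Rightarrow> real" and B :: real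
  assumes G_measurable: "(\<lambda>z. G (fst z) (snd z)) \<in> borel_measurable (M \<Otimes>\<^sub>M L)"
    and G_bounded: "\<And>x g. x \<in> space M \<Longrightarrow> g \<in> space L \<Longrightarrow> \<bar>G x g\<bar> \<le> B"
begin

sublocale LL: pair_sigma_finite L L ..
sublocale LL: sigma_finite_measure "L \<Otimes>\<^sub>M L" by (rule LL.P.sigma_finite_measure_axioms)
sublocale MLL: pair_sigma_finite M "L \<Otimes>\<^sub>M L" ..

definition S :: "'b set \<Rightarrow> 'a \<Rightarrow> real" where
  "S D x = (\<integral>g. indicator D g * G x g \<partial>L)"

lemma G_measurable' [measurable (raw)]:
  assumes "f \<in> measurable K M" "g \<in> measurable K L"
  shows "(\<lambda>x. G (f x) (g x)) \<in> borel_measurable K"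
  using measurable_compose[OF measurable_Pair[OF assms] G_measurable] by simp

lemma S_measurable [measurable]:
  assumes [measurable]: "D \<in> sets L"
  shows "S D \<in> borel_measurable M"
  unfolding S_def by measurable

lemma integrable_indicator_G:
  assumes x: "x \<in> space M" and D [measurable]: "D \<in> sets L" and fin: "emeasure L D < \<infinity>"
  shows "integrable L (\<lambda>g. indicator D g * G x g)"
proof (rule Bochner_Integration.integrable_bound)
  show "integrable L (\<lambda>g. B * indicator D g)"
    using D fin by simp
  show "(\<lambda>g. indicator D g * G x g) \<in> borel_measurable L"
    using x by measurable
  show "AE g in L. norm (indicator D g * G x g) \<le> norm (B * indicator D g)"
    using G_bounded[OF x] by (intro AE_I2) (force simp: indicator_def)
qed

lemma S_bound:
  assumes x: "x \<in> space M" and D: "D \<in> sets L" "emeasure L D < \<infinity>"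
  shows "\<bar>S D x\<bar> \<le> B * measure L D"
proof -
  have "\<bar>S D x\<bar> \<le> (\<integral>g. norm (indicator D g * G x g) \<partial>L)"
    unfolding S_def using integral_norm_bound[of L "\<lambda>g. indicator D g * G x g"] by simp
  also have "\<dots> \<le> (\<integral>g. B * indicator D g \<partial>L)"
  proof (rule integral_mono)
    show "integrable L (\<lambda>g. norm (indicator D g * G x g))"
      using integrable_indicator_G[OF x D] by simp
    show "integrable L (\<lambda>g. B * indicator D g)" using D by simp
    show "norm (indicator D g * G x g) \<le> B * indicator D g" if "g \<in> space L" for g
      using G_bounded[OF x that] by (auto simp: indicator_def)
  qed
  also have "\<dots> = B * measure L D"
    using D by (simp add: Int_absorb2 sets.sets_into_space)
  finally show ?thesis .
qed

lemma S_diff: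
  assumes x: "x \<in> space M" and D: "D \<in> sets L" "emeasure L D < \<infinity>" and D': "D' \<in> sets L" "D' \<subseteq> D"
  shows "S (D - D') x = S D x - S D' x"
proof -
  have "emeasure L D' < \<infinity>"
    using emeasure_mono[OF D'(2) D(1)] D(2) by (simp add: order_le_less_trans)
  then have "S D x - S D' x = (\<integral>g. indicator D g * G x g - indicator D' g * G x g \<partial>L)"
    unfolding S_def using integrable_indicator_G[OF x] D D'
    by (intro Bochner_Integration.integral_diff[symmetric]) auto
  also have "\<dots> = S (D - D') x"
    unfolding S_def using D'(2)
    by (intro Bochner_Integration.integral_cong) (auto simp: indicator_def)
  finally show ?thesis ..
qed

lemma integrable_S_square:
  assumes D: "D \<in> sets L" "emeasure L D < \<infinity>"
  shows "integrable M (\<lambda>x. (S D x)\<^sup>2)"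
proof (rule integrable_const_bound[where B = "(B * measure L D)\<^sup>2"])
  show "AE x in M. norm ((S D x)\<^sup>2) \<le> (B * measure L D)\<^sup>2"
    using S_bound[OF _ D] by (intro AE_I2) (fastforce simp: abs_le_square_iff[symmetric] intro: order_trans)
  show "(\<lambda>x. (S D x)\<^sup>2) \<in> borel_measurable M" using D by measurable
qed

text \<open>A Schur test: the square of \<open>S D\<close> is an integral over
  \<open>D \<times> D\<close>, Fubini moves the expectation inside, and the kernel of correlations
  has row integrals at most \<open>\<kappa>\<close>, which leaves one factor
  \<open>measure L D\<close>. This linear growth in the measure makes the bounds additive over
  disjoint sets.\<close>

lemma second_moment_bound:
  assumes D [measurable]: "D \<in> sets L" and fin: "emeasure L D < \<infinity>" and \<kappa>: "0 \<le> \<kappa>"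
    and kernel: "\<And>g. g \<in> D \<Longrightarrow>
      (\<integral>\<^sup>+g'. indicator D g' * ennreal \<bar>\<integral>x. G x g * G x g' \<partial>M\<bar> \<partial>L) \<le> ennreal \<kappa>"
  shows "(\<integral>x. (S D x)\<^sup>2 \<partial>M) \<le> \<kappa> * measure L D"
proof -
  let ?P = "\<lambda>x p. (indicator D (fst p) * G x (fst p)) * (indicator D (snd p) * G x (snd p))"
  let ?H = "\<lambda>p. \<integral>x. ?P x p \<partial>M"
  have DD: "D \<times> D \<in> sets (L \<Otimes>\<^sub>M L)" by measurable
  have finDD: "emeasure (L \<Otimes>\<^sub>M L) (D \<times> D) < \<infinity>"
    using fin by (simp add: L.emeasure_pair_measure_Times ennreal_mult_less_top)
  \<comment> \<open>A constant on \<open>D \<times> D\<close>, a set of finite measure, dominates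
    the integrand. It serves both uses of Fubini: over pairs of points for fixed \<open>x\<close>,
    and jointly with \<open>x\<close>.\<close>
  have bound: "norm (?P x p) \<le> norm (B\<^sup>2 * indicator (D \<times> D) p)"
    if "x \<in> space M" "p \<in> space (L \<Otimes>\<^sub>M L)" for x p
  proof -
    have "\<bar>G x (fst p)\<bar> \<le> B" "\<bar>G x (snd p)\<bar> \<le> B"
      using that G_bounded by (auto simp: space_pair_measure)
    then have "\<bar>G x (fst p)\<bar> * \<bar>G x (snd p)\<bar> \<le> B * B" by (intro mult_mono) auto
    then show ?thesis by (auto simp: indicator_def abs_mult power2_eq_square mem_Times_iff)
  qed
  have sq: "(S D x)\<^sup>2 = (\<integral>p. ?P x p \<partial>(L \<Otimes>\<^sub>M L))" if x: "x \<in> space M" for x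
  proof -
    have "integrable (L \<Otimes>\<^sub>M L) (\<lambda>p. ?P x p)"
    proof (rule Bochner_Integration.integrable_bound)
      show "integrable (L \<Otimes>\<^sub>M L) (\<lambda>p. B\<^sup>2 * indicator (D \<times> D) p)"
        using DD finDD by (intro integrable_mult_right integrable_real_indicator) auto
      show "(\<lambda>p. ?P x p) \<in> borel_measurable (L \<Otimes>\<^sub>M L)" using x by measurable
      show "AE p in L \<Otimes>\<^sub>M L. norm (?P x p) \<le> norm (B\<^sup>2 * indicator (D \<times> D) p)"
        using bound[OF x] by (intro AE_I2) auto
    qed
    then show ?thesis
      using LL.integral_fst'[of "\<lambda>p. ?P x p"] by (simp add: S_def power2_eq_square)
  qed
  have int: "integrable (M \<Otimes>\<^sub>M (L \<Otimes>\<^sub>M L)) (\<lambda>(x, p). ?P x p)"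
  proof (rule Bochner_Integration.integrable_bound)
    show "integrable (M \<Otimes>\<^sub>M (L \<Otimes>\<^sub>M L)) (\<lambda>z. B\<^sup>2 * indicator (space M \<times> (D \<times> D)) z)"
      using DD finDD
      by (intro integrable_mult_right integrable_real_indicator)
         (auto simp: LL.emeasure_pair_measure_Times emeasure_space_1)
    show "(\<lambda>(x, p). ?P x p) \<in> borel_measurable (M \<Otimes>\<^sub>M (L \<Otimes>\<^sub>M L))" by measurable
    show "AE z in M \<Otimes>\<^sub>M (L \<Otimes>\<^sub>M L). norm (case z of (x, p) \<Rightarrow> ?P x p)
        \<le> norm (B\<^sup>2 * indicator (space M \<times> (D \<times> D)) z)"
    proof (rule AE_I2)
      fix z assume "z \<in> space (M \<Otimes>\<^sub>M (L \<Otimes>\<^sub>M L))"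
      then have z: "fst z \<in> space M" "snd z \<in> space (L \<Otimes>\<^sub>M L)"
        by (auto simp: space_pair_measure)
      with bound[OF z] show "norm (case z of (x, p) \<Rightarrow> ?P x p)
          \<le> norm (B\<^sup>2 * indicator (space M \<times> (D \<times> D)) z)"
        by (simp add: case_prod_beta indicator_def mem_Times_iff)
    qed
  qed
  have "(\<integral>x. (S D x)\<^sup>2 \<partial>M) = (\<integral>x. (\<integral>p. ?P x p \<partial>(L \<Otimes>\<^sub>M L)) \<partial>M)"
    using sq by (intro Bochner_Integration.integral_cong) auto
  also have "\<dots> = (\<integral>p. ?H p \<partial>(L \<Otimes>\<^sub>M L))"
    using MLL.Fubini_integral[OF int] by simp
  \<comment> \<open>With absolute values the integrand is nonnegative, so the integral can be
    iterated and estimated row by row in \<open>ennreal\<close>.\<close>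
  also have "ennreal \<dots> \<le> (\<integral>\<^sup>+p. ennreal \<bar>?H p\<bar> \<partial>(L \<Otimes>\<^sub>M L))"
  proof -
    have "ennreal (\<integral>p. ?H p \<partial>(L \<Otimes>\<^sub>M L)) \<le> ennreal (norm (\<integral>p. ?H p \<partial>(L \<Otimes>\<^sub>M L)))"
      by (intro ennreal_leI) simp
    also have "\<dots> \<le> (\<integral>\<^sup>+p. ennreal (norm (?H p)) \<partial>(L \<Otimes>\<^sub>M L))"
      by (rule integral_norm_bound_ennreal) (rule MLL.integrable_snd[OF int])
    finally show ?thesis by simp
  qed
  also have "\<dots> = (\<integral>\<^sup>+g. \<integral>\<^sup>+g'. ennreal \<bar>?H (g, g')\<bar> \<partial>L \<partial>L)"
    by (subst L.nn_integral_fst[symmetric]) auto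
  also have "\<dots> \<le> (\<integral>\<^sup>+g. ennreal \<kappa> * indicator D g \<partial>L)"
  proof (rule nn_integral_mono)
    fix g assume "g \<in> space L"
    show "(\<integral>\<^sup>+g'. ennreal \<bar>?H (g, g')\<bar> \<partial>L) \<le> ennreal \<kappa> * indicator D g"
    proof (cases "g \<in> D")
      case True
      have "(\<integral>\<^sup>+g'. ennreal \<bar>?H (g, g')\<bar> \<partial>L)
          = (\<integral>\<^sup>+g'. indicator D g' * ennreal \<bar>\<integral>x. G x g * G x g' \<partial>M\<bar> \<partial>L)"
        using True by (intro nn_integral_cong) (auto simp: indicator_def)
      with kernel[OF True] True show ?thesis by simp
    qed simp
  qed
  also have "\<dots> = ennreal (\<kappa> * measure L D)"
    using fin \<kappa> by (simp add: nn_integral_cmult_indicator emeasure_eq_ennreal_measure ennreal_mult)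
  finally show ?thesis using \<kappa> by (simp add: ennreal_le_iff)
qed

text \<open>Rademacher--Menshov at all scales \<open>N\<close> at once. The shells between
  consecutive sets of one dyadic level are disjoint, so their second moments add up to at most
  \<open>\<kappa> * V N\<close>; there are \<open>N + 1\<close> levels, and chaining costs another
  \<open>N + 1\<close>. A further \<open>(real N + 1) powr (1 + 2 * \<epsilon>)\<close> buys
  summability over \<open>N\<close>, and the square root of the product gives the exponent
  \<open>3 / 2 + \<epsilon>\<close>. Each scale may have its own family \<open>E N\<close>, while
  \<open>c\<close> is common to all scales.\<close>

lemma AE_chaining_bound:
  fixes E :: "nat \<Rightarrow> nat \<Rightarrow> 'b set" and V :: "nat \<Rightarrow> real"
  assumes E_sets: "\<And>N j. E N j \<in> sets L" and E_mono: "\<And>N. mono (E N)"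
    and fin: "\<And>N j. emeasure L (E N j) < \<infinity>"
    and V: "\<And>N. measure L (E N (2 ^ N)) \<le> V N" "\<And>N. 0 < V N"
    and \<kappa>: "0 \<le> \<kappa>" and \<epsilon>: "0 < \<epsilon>"
    and moment: "\<And>N D. D \<in> sets L \<Longrightarrow> D \<subseteq> E N (2 ^ N) \<Longrightarrow>
      (\<integral>x. (S D x)\<^sup>2 \<partial>M) \<le> \<kappa> * measure L D"
  shows "AE x in M. \<exists>c\<ge>0. \<forall>N. \<forall>j\<le>2 ^ N.
    \<bar>S (E N j) x - S (E N 0) x\<bar> \<le> c * sqrt (V N) * (real N + 1) powr (3 / 2 + \<epsilon>)"
proof -
  define Z where "Z N x = (\<Sum>l\<le>N. \<Sum>i<2 ^ (N - l).
    (S (E N (Suc i * 2 ^ l)) x - S (E N (i * 2 ^ l)) x)\<^sup>2)" for N x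
  \<comment> \<open>\<open>a N\<close> is the normalisation of \<open>Z N\<close>, and
    \<open>b N\<close> bounds the expectation of \<open>Z N / a N\<close>. The exponents are
    balanced so that \<open>a N * b N = (real N + 1) * \<kappa> * V N\<close> while \<open>b\<close>
    stays summable.\<close>
  define a where "a N = V N * (real N + 1) powr (2 + 2 * \<epsilon>)" for N
  define b where "b N = \<kappa> * (real N + 1) powr (- 1 - 2 * \<epsilon>)" for N
  have a_pos: "0 < a N" for N using V(2) by (simp add: a_def)
  have [measurable]: "Z N \<in> borel_measurable M" for N
    unfolding Z_def using E_sets by measurable
  have Z_nonneg: "0 \<le> Z N x" for N x by (auto simp: Z_def intro!: sum_nonneg)
  have incr: "integrable M (\<lambda>x. (S (E N q) x - S (E N p) x)\<^sup>2)
      \<and> (\<integral>x. (S (E N q) x - S (E N p) x)\<^sup>2 \<partial>M) \<le> \<kappa> * (measure L (E N q) - measure L (E N p))"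
    if "p \<le> q" "q \<le> 2 ^ N" for N p q
  proof -
    have sub: "E N p \<subseteq> E N q" "E N q \<subseteq> E N (2 ^ N)" using E_mono that by (auto dest: monoD)
    have diff: "S (E N q - E N p) x = S (E N q) x - S (E N p) x" if "x \<in> space M" for x
      using S_diff[OF that E_sets fin E_sets sub(1)] .
    have D: "E N q - E N p \<in> sets L" using E_sets by auto
    have "emeasure L (E N q - E N p) \<le> emeasure L (E N q)"
      using E_sets by (intro emeasure_mono) auto
    then have finD: "emeasure L (E N q - E N p) < \<infinity>" using fin by (rule order_le_less_trans)
    have "integrable M (\<lambda>x. (S (E N q) x - S (E N p) x)\<^sup>2)"
      using integrable_S_square[OF D finD] diff
      by (subst Bochner_Integration.integrable_cong[OF refl]) auto
    moreover have "(\<integral>x. (S (E N q) x - S (E N p) x)\<^sup>2 \<partial>M) = (\<integral>x. (S (E N q - E N p) x)\<^sup>2 \<partial>M)"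
      using diff by (intro Bochner_Integration.integral_cong) auto
    moreover have "\<dots> \<le> \<kappa> * measure L (E N q - E N p)" using sub(2) by (intro moment D) auto
    moreover have "measure L (E N q - E N p) = measure L (E N q) - measure L (E N p)"
      using fin[of N q] sub(1) E_sets by (intro measure_Diff) auto
    ultimately show ?thesis by simp
  qed
  have Z_int: "integrable M (Z N) \<and> (\<integral>x. Z N x \<partial>M) \<le> a N * b N" for N
  proof -
    have le: "Suc i * 2 ^ l \<le> 2 ^ N" if "l \<le> N" "i < 2 ^ (N - l)" for i l :: nat
    proof -
      have "Suc i * 2 ^ l \<le> 2 ^ (N - l) * 2 ^ l" using that by (intro mult_right_mono) auto
      also have "\<dots> = 2 ^ N" using that by (simp add: power_add[symmetric])
      finally show ?thesis .
    qed
    have int: "integrable M (\<lambda>x. (S (E N (Suc i * 2 ^ l)) x - S (E N (i * 2 ^ l)) x)\<^sup>2)"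
      "(\<integral>x. (S (E N (Suc i * 2 ^ l)) x - S (E N (i * 2 ^ l)) x)\<^sup>2 \<partial>M)
        \<le> \<kappa> * (measure L (E N (Suc i * 2 ^ l)) - measure L (E N (i * 2 ^ l)))"
      if "l \<le> N" "i < 2 ^ (N - l)" for i l
      using incr[OF _ le[OF that], of "i * 2 ^ l"] by auto
    have "(\<integral>x. Z N x \<partial>M) = (\<Sum>l\<le>N. \<Sum>i<2 ^ (N - l).
        \<integral>x. (S (E N (Suc i * 2 ^ l)) x - S (E N (i * 2 ^ l)) x)\<^sup>2 \<partial>M)"
      unfolding Z_def
      by (subst Bochner_Integration.integral_sum, (intro Bochner_Integration.integrable_sum int(1); simp),
          intro sum.cong refl Bochner_Integration.integral_sum int(1)) auto
    also have "\<dots> \<le> (\<Sum>l\<le>N. \<Sum>i<2 ^ (N - l).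
        \<kappa> * (measure L (E N (Suc i * 2 ^ l)) - measure L (E N (i * 2 ^ l))))"
      using int(2) by (intro sum_mono) auto
    \<comment> \<open>The measures of the shells of one level telescope, so every level contributes
      the same amount.\<close>
    also have "\<dots> = (\<Sum>l\<le>N. \<kappa> * (measure L (E N (2 ^ N)) - measure L (E N 0)))"
    proof (rule sum.cong[OF refl])
      fix l assume "l \<in> {..N}"
      then have "2 ^ (N - l) * 2 ^ l = (2 ^ N :: nat)" by (simp add: power_add[symmetric])
      then show "(\<Sum>i<2 ^ (N - l). \<kappa> * (measure L (E N (Suc i * 2 ^ l)) - measure L (E N (i * 2 ^ l))))
          = \<kappa> * (measure L (E N (2 ^ N)) - measure L (E N 0))"
        using sum_lessThan_telescope[of "\<lambda>i. measure L (E N (i * 2 ^ l))" "2 ^ (N - l)"]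
        by (simp add: sum_distrib_left[symmetric])
    qed
    also have "\<dots> \<le> (\<Sum>l\<le>N. \<kappa> * V N)"
    proof (intro sum_mono mult_left_mono \<kappa>)
      show "measure L (E N (2 ^ N)) - measure L (E N 0) \<le> V N"
        using V(1)[of N] measure_nonneg[of L "E N 0"] by linarith
    qed
    also have "\<dots> = a N * b N"
      by (simp add: a_def b_def powr_add[symmetric] powr_one mult_ac flip: powr_mult_base)
    finally have "(\<integral>x. Z N x \<partial>M) \<le> a N * b N" .
    moreover have "integrable M (Z N)"
      unfolding Z_def by (intro Bochner_Integration.integrable_sum int(1)) auto
    ultimately show ?thesis by simp
  qed
  have b_sum: "summable b"
  proof -
    have "summable (\<lambda>n. real n powr (- 1 - 2 * \<epsilon>))"
      using \<epsilon> by (subst summable_real_powr_iff) auto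
    then have "summable (\<lambda>n. real (n + 1) powr (- 1 - 2 * \<epsilon>))"
      by (subst summable_iff_shift)
    then show ?thesis unfolding b_def by (intro summable_mult) (simp add: add.commute)
  qed
  \<comment> \<open>The sum over all \<open>N\<close> of the normalised \<open>Z N\<close> has
    finite expectation, hence is finite almost surely. Its value dominates each term and so provides
    one constant for every scale.\<close>
  have "(\<integral>\<^sup>+x. (\<Sum>N. ennreal (Z N x / a N)) \<partial>M) = (\<Sum>N. \<integral>\<^sup>+x. ennreal (Z N x / a N) \<partial>M)"
    by (intro nn_integral_suminf) measurable
  also have "\<dots> \<le> (\<Sum>N. ennreal (b N))"
  proof (intro suminf_le)
    fix N
    have "(\<integral>\<^sup>+x. ennreal (Z N x / a N) \<partial>M) = ennreal (\<integral>x. Z N x / a N \<partial>M)"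
      using Z_int Z_nonneg a_pos[THEN less_imp_le] by (intro nn_integral_eq_integral) auto
    also have "\<dots> \<le> ennreal (b N)"
      using Z_int[of N] a_pos[of N] by (intro ennreal_leI) (simp add: field_simps)
    finally show "(\<integral>\<^sup>+x. ennreal (Z N x / a N) \<partial>M) \<le> ennreal (b N)" .
  qed auto
  also have "\<dots> < \<infinity>"
    using b_sum \<kappa> by (subst suminf_ennreal2) (auto simp: b_def)
  finally have "AE x in M. (\<Sum>N. ennreal (Z N x / a N)) \<noteq> \<infinity>"
    by (intro nn_integral_noteq_infinite) auto
  then show ?thesis
  proof eventually_elim
    case (elim x)
    define c where "c = enn2real (\<Sum>N. ennreal (Z N x / a N))"
    have c: "Z N x \<le> c * a N" for N
    proof -
      have "ennreal (Z N x / a N) = (\<Sum>i\<in>{N}. ennreal (Z i x / a i))" by simp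
      also have "\<dots> \<le> (\<Sum>i. ennreal (Z i x / a i))" by (intro sum_le_suminf) auto
      also have "\<dots> = ennreal c" using elim by (simp add: c_def less_top)
      finally have "Z N x / a N \<le> c" by (simp add: c_def)
      then show ?thesis using a_pos[of N] by (simp add: field_simps)
    qed
    have "\<bar>S (E N j) x - S (E N 0) x\<bar> \<le> sqrt c * sqrt (V N) * (real N + 1) powr (3 / 2 + \<epsilon>)"
      if "j \<le> 2 ^ N" for N j
    proof -
      have "(S (E N j) x - S (E N 0) x)\<^sup>2 \<le> (real N + 1) * Z N x"
        unfolding Z_def by (rule dyadic_chaining_square[OF that])
      also have "\<dots> \<le> (real N + 1) * (c * a N)" using c by (intro mult_left_mono) auto
      also have "\<dots> = c * V N * ((real N + 1) powr (3 / 2 + \<epsilon>))\<^sup>2"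
      proof -
        have "(real N + 1) * (real N + 1) powr (2 + 2 * \<epsilon>) = (real N + 1) powr (3 + 2 * \<epsilon>)"
          using powr_mult_base[of "real N + 1" "2 + 2 * \<epsilon>"] by (simp add: add.commute)
        moreover have "((real N + 1) powr (3 / 2 + \<epsilon>))\<^sup>2 = (real N + 1) powr (3 + 2 * \<epsilon>)"
          by (simp add: power2_eq_square powr_add[symmetric])
        ultimately show ?thesis by (simp add: a_def mult_ac)
      qed
      finally have "sqrt ((S (E N j) x - S (E N 0) x)\<^sup>2)
          \<le> sqrt (c * V N * ((real N + 1) powr (3 / 2 + \<epsilon>))\<^sup>2)"
        by (rule real_sqrt_le_mono)
      then show ?thesis by (simp add: real_sqrt_mult)
    qed
    then show ?case by (intro exI[of _ "sqrt c"]) (auto simp: c_def)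
  qed
qed

end

section \<open>Volumes in the hyperplane\<close>

lemma emeasure_PiM_cube:
  assumes "finite I" "0 \<le> R"
  shows "emeasure (PiM I (\<lambda>_. lborel)) (PiE I (\<lambda>_. {0..R})) = ennreal (R ^ card I)"
proof -
  interpret product_sigma_finite "\<lambda>_. lborel :: real measure" ..
  show ?thesis using assms by (simp add: emeasure_PiM ennreal_power)
qed

text \<open>Coordinate \<open>i\<close> is integrated first: along it \<open>f\<close> is affine
  with slope \<open>\<alpha>\<close>, so each slice has length at most
  \<open>(b - a) / \<alpha>\<close>, whatever the other coordinates are. These fill a cube of one
  dimension less.\<close>

lemma emeasure_PiM_slab_le:
  fixes f :: "('i \<Rightarrow> real) \<Rightarrow> real"
  assumes I: "finite I" "i \<in> I" and f [measurable]: "f \<in> borel_measurable (PiM I (\<lambda>_. lborel))"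
    and affine: "\<And>x y. f (x(i := y)) = \<alpha> * y + f (x(i := 0))" and \<alpha>: "0 < \<alpha>"
    and R: "0 \<le> R" and ab: "a \<le> b"
  shows "emeasure (PiM I (\<lambda>_. lborel)) {x \<in> PiE I (\<lambda>_. {0..R}). f x \<in> {a..b}}
    \<le> ennreal (R ^ (card I - 1) * ((b - a) / \<alpha>))"
proof -
  interpret product_sigma_finite "\<lambda>_. lborel :: real measure" ..
  define J where "J = I - {i}"
  have J: "I = insert i J" "finite J" "i \<notin> J" using I by (auto simp: J_def)
  let ?A = "{x \<in> PiE I (\<lambda>_. {0..R}). f x \<in> {a..b}}"
  have [measurable]: "PiE I (\<lambda>_. {0..R}) \<in> sets (PiM I (\<lambda>_. lborel))"
    using I by (intro sets_PiM_I_finite) auto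
  have A_eq: "?A = PiE I (\<lambda>_. {0..R}) \<inter> {x \<in> space (PiM I (\<lambda>_. lborel)). f x \<in> {a..b}}"
    by (auto simp: space_PiM)
  have A: "?A \<in> sets (PiM I (\<lambda>_. lborel))" unfolding A_eq by measurable
  have "emeasure (PiM I (\<lambda>_. lborel)) ?A = (\<integral>\<^sup>+x. indicator ?A x \<partial>PiM I (\<lambda>_. lborel))"
    using A by simp
  also have "\<dots> = (\<integral>\<^sup>+x. \<integral>\<^sup>+y. indicator ?A (x(i := y)) \<partial>lborel \<partial>PiM J (\<lambda>_. lborel))"
    using A J unfolding J(1) by (subst product_nn_integral_insert) auto
  also have "\<dots> \<le> (\<integral>\<^sup>+x. ennreal ((b - a) / \<alpha>) * indicator (PiE J (\<lambda>_. {0..R})) x \<partial>PiM J (\<lambda>_. lborel))"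
  proof (rule nn_integral_mono)
    fix x assume x: "x \<in> space (PiM J (\<lambda>_. lborel :: real measure))"
    let ?c = "f (x(i := 0))"
    have "(\<integral>\<^sup>+y. indicator ?A (x(i := y)) \<partial>lborel)
        \<le> (\<integral>\<^sup>+y. indicator (PiE J (\<lambda>_. {0..R})) x * indicator {(a - ?c) / \<alpha>..(b - ?c) / \<alpha>} y \<partial>lborel)"
    proof (rule nn_integral_mono)
      fix y :: real
      show "indicator ?A (x(i := y))
        \<le> (indicator (PiE J (\<lambda>_. {0..R})) x * indicator {(a - ?c) / \<alpha>..(b - ?c) / \<alpha>} y :: ennreal)"
      proof (cases "x(i := y) \<in> ?A")
        case True
        have "x j \<in> {0..R}" if "j \<in> J" for j
        proof -
          have "(x(i := y)) j \<in> {0..R}" using True that J(1) by (auto simp: PiE_iff)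
          then show ?thesis using that J(3) by (metis fun_upd_apply)
        qed
        then have "x \<in> PiE J (\<lambda>_. {0..R})" using x by (auto simp: space_PiM PiE_iff)
        moreover have "y \<in> {(a - ?c) / \<alpha>..(b - ?c) / \<alpha>}"
          using True \<alpha> by (auto simp: affine[of x y] field_simps)
        ultimately show ?thesis by (simp add: indicator_def)
      qed simp
    qed
    also have "\<dots> = ennreal ((b - a) / \<alpha>) * indicator (PiE J (\<lambda>_. {0..R})) x"
      using \<alpha> ab by (subst nn_integral_cmult) (auto simp: divide_right_mono diff_divide_distrib mult.commute)
    finally show "(\<integral>\<^sup>+y. indicator ?A (x(i := y)) \<partial>lborel) \<le> \<dots>" .
  qed
  also have "\<dots> = ennreal ((b - a) / \<alpha>) * ennreal (R ^ card J)"
    using J(2) R by (subst nn_integral_cmult_indicator) (auto simp: emeasure_PiM_cube intro!: sets_PiM_I_finite)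
  also have "\<dots> = ennreal (R ^ (card I - 1) * ((b - a) / \<alpha>))"
    using J R ab \<alpha> by (simp add: ennreal_mult[symmetric] mult.commute)
  finally show ?thesis .
qed

text \<open>After translation by \<open>c\<close> the integrand is at most the sum of a one-sided
  exponential and its mirror image, each of integral \<open>1 / a\<close>.\<close>

lemma nn_integral_exp_neg_abs:
  fixes a c :: real
  assumes a: "0 < a"
  shows "(\<integral>\<^sup>+y. ennreal (exp (- a * \<bar>c - y\<bar>)) \<partial>lborel) \<le> ennreal (2 / a)"
proof -
  have half: "(\<integral>\<^sup>+y. ennreal (exp (- a * y)) * indicator {0..} y \<partial>lborel) = ennreal (1 / a)"
  proof -
    have lim: "((\<lambda>y. - exp (- a * y) / a) \<longlongrightarrow> 0) at_top"
      using a by real_asymp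
    have "(\<integral>\<^sup>+y. ennreal (exp (- a * y)) * indicator {0..} y \<partial>lborel)
        = ennreal (0 - (- exp (- a * 0) / a))"
      using a by (intro nn_integral_FTC_atLeast lim) (auto intro!: derivative_eq_intros)
    then show ?thesis by simp
  qed
  have "(\<integral>\<^sup>+y. ennreal (exp (- a * \<bar>c - y\<bar>)) \<partial>lborel) = (\<integral>\<^sup>+y. ennreal (exp (- a * \<bar>y\<bar>)) \<partial>lborel)"
    by (subst nn_integral_real_affine[where c = 1 and t = c]) auto
  also have "\<dots> \<le> (\<integral>\<^sup>+y. ennreal (exp (- a * y)) * indicator {0..} y
      + ennreal (exp (- a * (0 + (- 1) * y))) * indicator {0..} (0 + (- 1) * y) \<partial>lborel)"
    by (intro nn_integral_mono) (auto simp: indicator_def)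
  also have "\<dots> = ennreal (1 / a) + ennreal (1 / a)"
    using half nn_integral_real_affine[of "\<lambda>y. ennreal (exp (- a * y)) * indicator {0..} y" "-1" 0]
    by (subst nn_integral_add) auto
  also have "\<dots> = ennreal (2 / a)" using a by (simp flip: ennreal_plus)
  finally show ?thesis .
qed

text \<open>The exponential of a sum over coordinates is a product, so the integral factorises. For
  this reason distances are later measured by the sum of the coordinate differences.\<close>

lemma nn_integral_PiM_exp_neg_l1:
  fixes a :: real and g :: "'i \<Rightarrow> real"
  assumes I: "finite I" and a: "0 < a"
  shows "(\<integral>\<^sup>+h. ennreal (exp (- a * (\<Sum>i\<in>I. \<bar>g i - h i\<bar>))) \<partial>PiM I (\<lambda>_. lborel)) \<le> ennreal ((2 / a) ^ card I)"
proof -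
  interpret product_sigma_finite "\<lambda>_. lborel :: real measure" ..
  have "(\<integral>\<^sup>+h. ennreal (exp (- a * (\<Sum>i\<in>I. \<bar>g i - h i\<bar>))) \<partial>PiM I (\<lambda>_. lborel))
      = (\<integral>\<^sup>+h. (\<Prod>i\<in>I. ennreal (exp (- a * \<bar>g i - h i\<bar>))) \<partial>PiM I (\<lambda>_. lborel))"
    using I by (simp add: prod_ennreal exp_sum[symmetric] sum_distrib_left sum_negf)
  also have "\<dots> = (\<Prod>i\<in>I. \<integral>\<^sup>+y. ennreal (exp (- a * \<bar>g i - y\<bar>)) \<partial>lborel)"
    using I by (subst product_nn_integral_prod) auto
  also have "\<dots> \<le> (\<Prod>i\<in>I. ennreal (2 / a))"
    using I a by (induction I) (auto intro!: mult_mono nn_integral_exp_neg_abs[OF a, simplified])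
  also have "\<dots> = ennreal ((2 / a) ^ card I)"
    using a by (simp add: ennreal_power)
  finally show ?thesis .
qed

section \<open>The cone as a graph over its first \<open>k + r - 1\<close> coordinates\<close>

locale weighted_hyperplane =
  fixes k r :: nat and m n :: "nat \<Rightarrow> nat"
  assumes k: "1 \<le> k" and r: "1 \<le> r"
    and m_pos: "\<And>i. i < k \<Longrightarrow> 0 < m i" and n_pos: "\<And>j. j < r \<Longrightarrow> 0 < n j"
begin

definition d :: nat where "d = k + r - 1"

definition L :: "(nat \<Rightarrow> real) measure" where "L = PiM {..<d} (\<lambda>_. lborel)"

text \<open>The right side of the defining equation when every s-coordinate is 1;
  \<open>w * T\<close> bounds all coordinates of a point of \<open>JT k r m n T\<close>.\<close>

definition w :: real where "w = (\<Sum>j<r. real (n j))"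

definition cube :: "real \<Rightarrow> (nat \<Rightarrow> real) set" where "cube R = PiE {..<d} (\<lambda>_. {0..R})"

definition J :: "real \<Rightarrow> (nat \<Rightarrow> real) set" where
  "J T = {g \<in> space L. lift k r m n g \<in> JT k r m n T}"

text \<open>All \<open>k + r\<close> coordinates are constrained, the solved one included, so that
  the bound passes to \<open>minabs\<close> of the lifted point.\<close>

definition bulk :: "real \<Rightarrow> (nat \<Rightarrow> real) set" where
  "bulk b = {g \<in> space L. \<forall>p<k + r. b \<le> lift k r m n g p}"

lemma d_pos: "0 < d" using k r by (simp add: d_def)
lemma kr: "k + r = Suc d" using k r by (simp add: d_def)

lemma w_ge_1: "1 \<le> w"
proof -
  have "1 \<le> real (n 0)" using n_pos[of 0] r by simp
  also have "\<dots> \<le> w" unfolding w_def using r by (intro member_le_sum) auto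
  finally show ?thesis .
qed

lemma lastcoord_measurable [measurable]: "lastcoord k r m n \<in> borel_measurable L"
proof -
  have [measurable]: "(\<lambda>g. g i) \<in> borel_measurable L" if "i < d" for i
    using that unfolding L_def by simp
  have "i < d" if "i < k" for i using that k r by (simp add: d_def)
  moreover have "k + j < d" if "j < r - 1" for j using that k r by (simp add: d_def)
  ultimately show ?thesis unfolding lastcoord_def by measurable
qed

lemma lift_measurable [measurable]: "lift k r m n \<in> measurable L (PiM {..<k + r} (\<lambda>_. lborel))"
proof (rule measurable_PiM_single')
  show "(\<lambda>g. lift k r m n g i) \<in> measurable L lborel" if "i \<in> {..<k + r}" for i
  proof (cases "i < d")
    case True
    then show ?thesis unfolding lift_def d_def[symmetric] L_def by simp
  next
    case False
    then have "(\<lambda>g. lift k r m n g i) = lastcoord k r m n"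
      using that by (auto simp: lift_def kr fun_eq_iff)
    then show ?thesis by simp
  qed
  show "lift k r m n \<in> space L \<rightarrow> {..<k + r} \<rightarrow>\<^sub>E space lborel"
    using kr by (auto simp: lift_def PiE_iff extensional_def)
qed

lemma lift_component_measurable [measurable]:
  assumes "p < k + r"
  shows "(\<lambda>g. lift k r m n g p) \<in> borel_measurable L"
proof -
  have "(\<lambda>h. h p) \<in> measurable (PiM {..<k + r} (\<lambda>_. lborel :: real measure)) lborel"
    using assms by (intro measurable_component_singleton) simp
  from measurable_compose[OF lift_measurable this] show ?thesis by simp
qed

lemma lift_equation:
  "(\<Sum>i<k. real (m i) * lift k r m n g i) = (\<Sum>j<r. real (n j) * lift k r m n g (k + j))"
proof -
  have r': "r = Suc (r - 1)" using r by simp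
  have "(\<Sum>j<r. real (n j) * lift k r m n g (k + j))
      = (\<Sum>j<r - 1. real (n j) * g (k + j)) + real (n (r - 1)) * lastcoord k r m n g"
    by (subst r', subst sum.lessThan_Suc) (use r in \<open>auto simp: lift_def intro!: sum.cong\<close>)
  also have "\<dots> = (\<Sum>i<k. real (m i) * g i)"
    using n_pos[of "r - 1"] r by (simp add: lastcoord_def)
  also have "\<dots> = (\<Sum>i<k. real (m i) * lift k r m n g i)"
    using r by (auto simp: lift_def intro!: sum.cong)
  finally show ?thesis ..
qed

lemma lift_in_orth_iff: "lift k r m n g \<in> orth (k + r) \<longleftrightarrow> (\<forall>p<k + r. 0 \<le> lift k r m n g p)"
  by (auto simp: orth_def PiE_iff extensional_def lift_def kr)

lemma lift_in_hypR_iff: "lift k r m n g \<in> hypR k r m n \<longleftrightarrow> lift k r m n g \<in> orth (k + r)"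
  using lift_equation by (simp add: hypR_def)

text \<open>A lifted point solves the hyperplane equation by construction, so only finitely many
  inequalities between coordinates remain. Measurability, monotonicity and the volume bounds are
  read off from this form.\<close>

lemma J_eq: "J T = {g \<in> space L. (\<forall>p<k + r. 0 \<le> lift k r m n g p) \<and> (\<forall>j<r. lift k r m n g (k + j) \<le> T)}"
  by (auto simp: J_def JT_def lift_in_hypR_iff lift_in_orth_iff)

lemma J_sets [measurable]: "J T \<in> sets L"
proof -
  have "J T = (\<Inter>p\<in>{..<k + r}. {g \<in> space L. 0 \<le> lift k r m n g p})
      \<inter> (\<Inter>j\<in>{..<r}. {g \<in> space L. lift k r m n g (k + j) \<le> T})"
    using k r by (fastforce simp: J_eq)
  also have "\<dots> \<in> sets L"
    using k r by (intro sets.Int sets.finite_INT borel_measurable_le lift_component_measurable)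
      (auto simp: lessThan_empty_iff)
  finally show ?thesis .
qed

lemma bulk_sets [measurable]: "bulk b \<in> sets L"
proof -
  have "bulk b = (\<Inter>p\<in>{..<k + r}. {g \<in> space L. b \<le> lift k r m n g p})"
    using k r by (fastforce simp: bulk_def)
  also have "\<dots> \<in> sets L"
    using k r by (intro sets.finite_INT borel_measurable_le lift_component_measurable)
      (auto simp: lessThan_empty_iff)
  finally show ?thesis .
qed

lemma J_mono: "S \<le> T \<Longrightarrow> J S \<subseteq> J T"
  by (force simp: J_eq)

text \<open>The weights are positive integers, so a t-coordinate is at most the whole weighted sum,
  which the equation turns into a combination of s-coordinates bounded by \<open>w * T\<close>. The
  s-coordinates themselves are at most \<open>T\<close>, and \<open>w\<close> is at least 1.\<close>

lemma J_subset_cube: "J T \<subseteq> cube (w * T)"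
proof
  fix g assume g: "g \<in> J T"
  let ?h = "lift k r m n g"
  have nonneg: "0 \<le> ?h p" if "p < k + r" for p using g that by (simp add: J_eq)
  have le_T: "?h (k + j) \<le> T" if "j < r" for j using g that by (simp add: J_eq)
  \<comment> \<open>A point in \<open>J T\<close> forces \<open>T\<close> to be nonnegative; for
    negative \<open>T\<close> the inclusion is vacuous.\<close>
  have T: "0 \<le> T" using nonneg[of k] le_T[of 0] r by simp
  have "?h i \<le> w * T" if i: "i < k + r" for i
  proof (cases "i < k")
    case True
    have "?h i \<le> real (m i) * ?h i"
      using m_pos[OF True] nonneg[OF i] by (simp add: mult_le_cancel_right1)
    also have "\<dots> \<le> (\<Sum>i<k. real (m i) * ?h i)"
      using True nonneg by (intro member_le_sum) auto
    also have "\<dots> = (\<Sum>j<r. real (n j) * ?h (k + j))" by (rule lift_equation)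
    also have "\<dots> \<le> (\<Sum>j<r. real (n j) * T)" using le_T by (intro sum_mono mult_left_mono) auto
    also have "\<dots> = w * T" by (simp add: w_def sum_distrib_right)
    finally show ?thesis .
  next
    case False
    then have "?h i \<le> T" using le_T[of "i - k"] i by simp
    also have "\<dots> \<le> w * T" using w_ge_1 T by (simp add: mult_le_cancel_right1)
    finally show ?thesis .
  qed
  moreover have "?h i = g i" if "i < d" for i using that by (simp add: lift_def d_def)
  ultimately have "g i \<in> {0..w * T}" if "i < d" for i
    using nonneg[of i] that by (metis atLeastAtMost_iff kr less_Suc_eq)
  then show "g \<in> cube (w * T)"
    using g by (auto simp: cube_def J_def L_def space_PiM PiE_iff)
qed

lemma emeasure_cube: "0 \<le> R \<Longrightarrow> emeasure L (cube R) = ennreal (R ^ d)"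
  unfolding L_def cube_def by (subst emeasure_PiM_cube) auto

lemma cube_sets [measurable]: "cube R \<in> sets L"
  unfolding L_def cube_def by (intro sets_PiM_I_finite) auto

lemma emeasure_J_le:
  assumes "0 \<le> T"
  shows "emeasure L (J T) \<le> ennreal ((w * T) ^ d)"
  using emeasure_mono[OF J_subset_cube[of T] cube_sets] w_ge_1 assms by (simp add: emeasure_cube)

lemma finite_emeasure_J: "emeasure L (J T) < \<infinity>"
proof (cases "0 \<le> T")
  case True
  then show ?thesis using emeasure_J_le[OF True] by (simp add: order_le_less_trans)
next
  case False
  then have "J T \<subseteq> J 0" by (intro J_mono) simp
  then have "emeasure L (J T) \<le> emeasure L (J 0)" by (intro emeasure_mono) auto
  also have "\<dots> < \<infinity>" using emeasure_J_le[of 0] by (simp add: order_le_less_trans)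
  finally show ?thesis .
qed

lemma finite_emeasure_subset_J:
  assumes "D \<subseteq> J T"
  shows "emeasure L D < \<infinity>"
  using emeasure_mono[OF assms J_sets] finite_emeasure_J by (rule order_le_less_trans)

text \<open>Every coordinate of the lifted point has positive slope in some free coordinate: a free
  one in itself, with slope 1, and the solved one in the first coordinate, with slope
  \<open>m 0 / n (r - 1)\<close>. Both reciprocal slopes are at most \<open>n (r - 1)\<close>, which
  gives a common constant.\<close>

lemma emeasure_slab_le:
  assumes p: "p < k + r" and R: "0 \<le> R" and ab: "a \<le> b"
  shows "emeasure L {g \<in> cube R. lift k r m n g p \<in> {a..b}}
    \<le> ennreal (real (n (r - 1)) * R ^ (d - 1) * (b - a))"
proof -
  have n1: "1 \<le> real (n (r - 1))" using n_pos[of "r - 1"] r by simp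
  have gen: ?thesis if i: "i < d" and \<alpha>: "0 < \<alpha>" "1 / \<alpha> \<le> real (n (r - 1))"
    and affine: "\<And>x y. lift k r m n (x(i := y)) p = \<alpha> * y + lift k r m n (x(i := 0)) p" for i \<alpha>
  proof -
    have "emeasure L {g \<in> cube R. lift k r m n g p \<in> {a..b}} \<le> ennreal (R ^ (card {..<d} - 1) * ((b - a) / \<alpha>))"
      unfolding L_def cube_def
      using i p by (intro emeasure_PiM_slab_le[where i = i] affine \<alpha> R ab)
        (auto intro: lift_component_measurable[unfolded L_def])
    also have "\<dots> \<le> ennreal (R ^ (d - 1) * ((b - a) * real (n (r - 1))))"
    proof -
      have "(b - a) / \<alpha> \<le> (b - a) * real (n (r - 1))"
        using mult_left_mono[OF \<alpha>(2), of "b - a"] ab by simp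
      then have "R ^ (d - 1) * ((b - a) / \<alpha>) \<le> R ^ (d - 1) * ((b - a) * real (n (r - 1)))"
        by (rule mult_left_mono) (use R in simp)
      then show ?thesis by (simp only: card_lessThan ennreal_leI)
    qed
    finally show ?thesis by (simp add: mult_ac)
  qed
  show ?thesis
  proof (cases "p < d")
    case True
    then show ?thesis using n1 by (intro gen[of p 1]) (auto simp: lift_def d_def)
  next
    case False
    then have p: "p = d" using p kr by simp
    let ?\<alpha> = "real (m 0) / real (n (r - 1))"
    have m0: "0 < m 0" using m_pos k by simp
    have affine: "lastcoord k r m n (x(0 := y)) = ?\<alpha> * y + lastcoord k r m n (x(0 := 0))" for x y
    proof -
      have "(\<Sum>i<k. real (m i) * (x(0 := z)) i) = real (m 0) * z + (\<Sum>i\<in>{..<k} - {0}. real (m i) * x i)" for z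
        using k by (subst sum.remove[of _ 0]) auto
      moreover have "(\<Sum>j<r - 1. real (n j) * (x(0 := z)) (k + j)) = (\<Sum>j<r - 1. real (n j) * x (k + j))" for z
        using k by (intro sum.cong) auto
      ultimately show ?thesis unfolding lastcoord_def by (simp add: add_divide_distrib diff_divide_distrib)
    qed
    have lift_p: "lift k r m n g p = lastcoord k r m n g" for g
      using p by (simp add: lift_def d_def)
    show ?thesis
    proof (rule gen[of 0 ?\<alpha>])
      show "0 < ?\<alpha>" using m0 n1 by simp
      show "1 / ?\<alpha> \<le> real (n (r - 1))"
        using m0 by (simp add: divide_le_eq mult_le_cancel_left1)
      show "lift k r m n (x(0 := y)) p = ?\<alpha> * y + lift k r m n (x(0 := 0)) p" for x y
        unfolding lift_p by (rule affine)
    qed (rule d_pos)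
  qed
qed

text \<open>Sets covered by thin slabs lose one power of \<open>R\<close>. Both the layer outside
  \<open>bulk\<close> and the shell between two values of \<open>T\<close> have this shape.\<close>

lemma emeasure_union_slabs_le:
  assumes R: "0 \<le> R" and ab: "a \<le> b" and D: "D \<subseteq> (\<Union>p<k + r. {g \<in> cube R. lift k r m n g p \<in> {a..b}})"
  shows "emeasure L D \<le> ennreal (real (k + r) * real (n (r - 1)) * R ^ (d - 1) * (b - a))"
proof -
  let ?A = "\<lambda>p. {g \<in> cube R. lift k r m n g p \<in> {a..b}}"
  have "?A p \<in> sets L" if "p < k + r" for p
  proof -
    have [measurable]: "(\<lambda>g. lift k r m n g p) \<in> borel_measurable L"
      using that by (rule lift_component_measurable)
    have "?A p = cube R \<inter> {g \<in> space L. lift k r m n g p \<in> {a..b}}"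
      using sets.sets_into_space[OF cube_sets] by auto
    also have "\<dots> \<in> sets L" by measurable
    finally show ?thesis .
  qed
  then have sets: "?A ` {..<k + r} \<subseteq> sets L" by auto
  have "emeasure L D \<le> emeasure L (\<Union>p<k + r. ?A p)"
    using D sets by (intro emeasure_mono) auto
  also have "\<dots> \<le> (\<Sum>p<k + r. emeasure L (?A p))"
    using sets by (intro emeasure_subadditive_finite) auto
  also have "\<dots> \<le> (\<Sum>p<k + r. ennreal (real (n (r - 1)) * R ^ (d - 1) * (b - a)))"
    using R ab by (intro sum_mono emeasure_slab_le) auto
  also have "\<dots> = ennreal (real (k + r) * real (n (r - 1)) * R ^ (d - 1) * (b - a))"
    using R ab by (subst sum_ennreal) (auto simp: mult_ac)
  finally show ?thesis .
qed

lemma emeasure_J_minus_bulk_le: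
  assumes "0 \<le> T" "0 \<le> b"
  shows "emeasure L (J T - bulk b) \<le> ennreal (real (k + r) * real (n (r - 1)) * (w * T) ^ (d - 1) * b)"
proof -
  have "J T - bulk b \<subseteq> (\<Union>p<k + r. {g \<in> cube (w * T). lift k r m n g p \<in> {0..b}})"
  proof
    fix g assume g: "g \<in> J T - bulk b"
    then obtain p where "p < k + r" "lift k r m n g p \<le> b" by (auto simp: bulk_def J_eq not_le)
    with g show "g \<in> (\<Union>p<k + r. {g \<in> cube (w * T). lift k r m n g p \<in> {0..b}})"
      using J_subset_cube by (auto simp: J_eq)
  qed
  from emeasure_union_slabs_le[OF _ assms(2) this] show ?thesis using assms w_ge_1 by simp
qed

lemma emeasure_J_minus_J_le:
  assumes "0 \<le> T'" "T' \<le> T"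
  shows "emeasure L (J T - J T') \<le> ennreal (real (k + r) * real (n (r - 1)) * (w * T) ^ (d - 1) * (T - T'))"
proof -
  have "J T - J T' \<subseteq> (\<Union>p<k + r. {g \<in> cube (w * T). lift k r m n g p \<in> {T'..T}})"
  proof
    fix g assume g: "g \<in> J T - J T'"
    then obtain j where "j < r" "T' < lift k r m n g (k + j)" by (auto simp: J_eq not_le)
    moreover from g this have "lift k r m n g (k + j) \<le> T" by (simp add: J_eq)
    moreover have "g \<in> cube (w * T)" using g J_subset_cube by auto
    ultimately show "g \<in> (\<Union>p<k + r. {g \<in> cube (w * T). lift k r m n g p \<in> {T'..T}})"
      by (intro UN_I[of "k + j"]) auto
  qed
  from emeasure_union_slabs_le[OF _ assms(2) this] show ?thesis using assms w_ge_1 by simp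
qed

text \<open>The maximum dominates the mean over the free coordinates. Passing to the sum makes the
  exponential decay factorise, at the cost of dividing its rate by \<open>d\<close>.\<close>

lemma supdist_lift_ge:
  "(\<Sum>i<d. \<bar>g i - g' i\<bar>) / real d \<le> supdist (k + r) (lift k r m n g) (lift k r m n g')"
proof -
  have "\<bar>g i - g' i\<bar> \<le> supdist (k + r) (lift k r m n g) (lift k r m n g')" if "i < d" for i
  proof -
    have "\<bar>lift k r m n g i - lift k r m n g' i\<bar> \<le> supdist (k + r) (lift k r m n g) (lift k r m n g')"
      unfolding supdist_def using that kr by (intro Max_ge) auto
    then show ?thesis using that by (simp add: lift_def d_def)
  qed
  then have "(\<Sum>i<d. \<bar>g i - g' i\<bar>) \<le> real (card {..<d}) * supdist (k + r) (lift k r m n g) (lift k r m n g')"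
    by (intro sum_bounded_above) auto
  then show ?thesis using d_pos by (simp add: field_simps)
qed

lemma minabs_lift_ge:
  assumes "g \<in> bulk b"
  shows "b \<le> minabs (k + r) (lift k r m n g)"
proof -
  have "b \<le> \<bar>lift k r m n g i\<bar>" if "i < k + r" for i
    using assms that by (force simp: bulk_def)
  then show ?thesis using k unfolding minabs_def by (subst Min_ge_iff) (auto simp: lessThan_empty_iff)
qed

end

section \<open>Almost sure bounds\<close>

lemma obtain_dyadic_scale:
  fixes T :: real
  assumes "2 \<le> T"
  obtains N :: nat where "T \<le> 2 ^ N" "2 ^ N \<le> 2 * T" "real N + 1 \<le> 6 * ln T"
proof -
  define N where "N = (LEAST N. T \<le> 2 ^ N)"
  have ex: "\<exists>N. T \<le> 2 ^ N" using real_arch_pow[of 2 T] by (auto intro: less_imp_le)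
  have N: "T \<le> 2 ^ N" unfolding N_def by (rule LeastI_ex[OF ex])
  have "N \<noteq> 0" using N assms by (intro notI) simp
  then obtain N' where N': "N = Suc N'" by (cases N) auto
  have lt: "2 ^ N' < T" using not_less_Least[of N' "\<lambda>N. T \<le> 2 ^ N"] N' by (simp add: N_def not_le)
  have "ln (2 ^ N') \<le> ln T" using lt assms by (subst ln_le_cancel_iff) auto
  then have "real N' * ln 2 \<le> ln T" by (simp add: ln_realpow)
  moreover have "2 / 3 \<le> ln (2::real)" by (rule ln2_ge_two_thirds)
  moreover have "ln 2 \<le> ln T" using assms by simp
  moreover from \<open>2 / 3 \<le> ln (2::real)\<close> have "real N' * (2 / 3) \<le> real N' * ln 2" by (intro mult_left_mono) auto
  \<comment> \<open>Here \<open>N'\<close> is at most \<open>3 / 2 * ln T\<close> and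
    \<open>2\<close> is at most \<open>3 * ln T\<close>, so the constant 6 leaves room.\<close>
  ultimately have "real N + 1 \<le> 6 * ln T" unfolding N' by simp
  with N lt N' show ?thesis by (intro that[of N]) auto
qed

lemma powr_ln_smallo:
  fixes a p q :: real
  assumes "p < q"
  shows "(\<lambda>T. T powr a * ln T powr p) \<in> o[at_top](\<lambda>T. T powr a * ln T powr q)"
  using assms by real_asymp

lemma inverse_ln_smallo_sqrt:
  fixes q :: real
  assumes "0 < q"
  shows "(\<lambda>T. T powr (-1) * ln T) \<in> o[at_top](\<lambda>T. T powr (-1/2) * ln T powr q)"
  using assms by real_asymp

section \<open>Moments and pathwise growth for a decorrelating field\<close>

locale decorrelating_field = weighted_hyperplane k r m n + prob_space M
  for k r :: nat and m n :: "nat \<Rightarrow> nat" and M :: "'a measure" +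
  fixes F :: "'a \<Rightarrow> (nat \<Rightarrow> real) \<Rightarrow> real" and B \<delta> C :: real
  assumes F_meas: "(\<lambda>z. F (fst z) (snd z)) \<in> borel_measurable
          (restrict_space (M \<Otimes>\<^sub>M PiM {..<k + r} (\<lambda>_. lborel)) (space M \<times> orth (k + r)))"
    and F_bdd: "\<And>x h. x \<in> space M \<Longrightarrow> h \<in> orth (k + r) \<Longrightarrow> \<bar>F x h\<bar> \<le> B"
    and B: "0 \<le> B" and \<delta>: "0 < \<delta>" and C: "0 < C"
    and decay: "\<And>h1 h2. h1 \<in> hypR k r m n \<Longrightarrow> h2 \<in> hypR k r m n \<Longrightarrow>
          \<bar>integral\<^sup>L M (\<lambda>x. F x h1 * F x h2)\<bar>
            \<le> C * exp (- \<delta> * min (min (minabs (k + r) h1) (minabs (k + r) h2))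
                                   (supdist (k + r) h1 h2))"
begin

text \<open>Measurability and boundedness of \<open>F\<close> are given on the orthant alone;
  extension by zero yields a bounded field on the whole parameter space with the same integrals over
  \<open>J T\<close>.\<close>

definition G :: "'a \<Rightarrow> (nat \<Rightarrow> real) \<Rightarrow> real" where
  "G x g = indicator (orth (k + r)) (lift k r m n g) * F x (lift k r m n g)"

lemma G_meas: "(\<lambda>z. G (fst z) (snd z)) \<in> borel_measurable (M \<Otimes>\<^sub>M L)"
proof -
  let ?P = "PiM {..<k + r} (\<lambda>_. lborel :: real measure)"
  have orth: "orth (k + r) \<in> sets ?P"
    unfolding orth_def by (intro sets_PiM_I_finite) auto
  then have \<Omega>: "(space M \<times> orth (k + r)) \<inter> space (M \<Otimes>\<^sub>M ?P) \<in> sets (M \<Otimes>\<^sub>M ?P)"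
    by (intro sets.Int pair_measureI) auto
  have "(\<lambda>z. indicator (space M \<times> orth (k + r)) z *\<^sub>R F (fst z) (snd z)) \<in> borel_measurable (M \<Otimes>\<^sub>M ?P)"
    using F_meas by (subst (asm) borel_measurable_restrict_space_iff[OF \<Omega>])
  moreover have "(\<lambda>z. (fst z, lift k r m n (snd z))) \<in> measurable (M \<Otimes>\<^sub>M L) (M \<Otimes>\<^sub>M ?P)"
    by measurable
  from measurable_compose[OF this calculation]
  have "(\<lambda>z. indicator (space M \<times> orth (k + r)) (fst z, lift k r m n (snd z))
      *\<^sub>R F (fst z) (lift k r m n (snd z))) \<in> borel_measurable (M \<Otimes>\<^sub>M L)"
    by simp
  then show ?thesis
    by (rule measurable_cong[THEN iffD1, rotated])
      (auto simp: G_def indicator_def space_pair_measure)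
qed

sublocale field: bounded_random_field M L G B
proof -
  interpret finite_product_sigma_finite "\<lambda>_. lborel :: real measure" "{..<d}"
    by standard auto
  have "sigma_finite_measure L" unfolding L_def by (rule sigma_finite_measure_axioms)
  then interpret L: sigma_finite_measure L .
  show "bounded_random_field M L G B"
  proof
    show "(\<lambda>z. G (fst z) (snd z)) \<in> borel_measurable (M \<Otimes>\<^sub>M L)" by (rule G_meas)
    show "\<bar>G x g\<bar> \<le> B" if "x \<in> space M" for x g
      using F_bdd[OF that] B by (auto simp: G_def indicator_def)
  qed
qed

lemma hyp_integral_eq: "hyp_integral k r m n T (F x) = hyp_factor k r m n * field.S (J T) x"
proof -
  have "JT k r m n T \<subseteq> orth (k + r)" by (auto simp: JT_def hypR_def)
  then have "(\<integral>g. indicator {g. lift k r m n g \<in> JT k r m n T} g * F x (lift k r m n g) \<partial>L) = field.S (J T) x"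
    unfolding field.S_def by (intro Bochner_Integration.integral_cong) (auto simp: J_def G_def indicator_def)
  then show ?thesis by (simp add: hyp_integral_def L_def d_def)
qed

text \<open>With this \<open>\<beta>\<close> the decay at distance \<open>\<beta> * N\<close> from the boundary is \<open>2 ^ (- d * N)\<close>, which cancels
  the volume of \<open>J (2 ^ N)\<close> in the second moment.\<close>

definition \<beta> :: real where "\<beta> = real d * ln 2 / \<delta>"

text \<open>The cut-off depends on \<open>N\<close> alone, so at a fixed scale the sets increase
  with \<open>j\<close>, as chaining requires.\<close>

definition E :: "nat \<Rightarrow> nat \<Rightarrow> (nat \<Rightarrow> real) set" where
  "E N j = J (real j) \<inter> bulk (\<beta> * real N)"

text \<open>The first term is the decay away from the boundary times the volume bound for
  \<open>J (2 ^ N)\<close>, the second the integral of the decay in the distance between two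
  points.\<close>

definition \<kappa> :: real where "\<kappa> = C * (w ^ d + (2 * real d / \<delta>) ^ d)"

text \<open>The exponential of minus a minimum is at most the sum of the exponentials. This
  separates the decay away from the boundary, made constant on \<open>E N j\<close> by the cut-off,
  from the decay in the distance.\<close>

lemma correlation_bound:
  assumes "g \<in> E N j" "g' \<in> E N j"
  shows "\<bar>\<integral>x. G x g * G x g' \<partial>M\<bar>
    \<le> C * ((1 / 2 ^ N) ^ d + exp (- (\<delta> / real d) * (\<Sum>i<d. \<bar>g i - g' i\<bar>)))"
proof -
  let ?l = "lift k r m n"
  let ?s = "supdist (k + r) (?l g) (?l g')"
  have orth: "?l g \<in> orth (k + r)" "?l g' \<in> orth (k + r)"
    using assms by (auto simp: E_def J_eq lift_in_orth_iff)
  then have hyp: "?l g \<in> hypR k r m n" "?l g' \<in> hypR k r m n" by (auto simp: lift_in_hypR_iff)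
  have "\<bar>\<integral>x. G x g * G x g' \<partial>M\<bar> = \<bar>\<integral>x. F x (?l g) * F x (?l g') \<partial>M\<bar>"
    using orth by (simp add: G_def)
  also have "\<dots> \<le> C * exp (- \<delta> * min (min (minabs (k + r) (?l g)) (minabs (k + r) (?l g'))) ?s)"
    by (rule decay[OF hyp])
  also have "\<dots> \<le> C * (exp (- \<delta> * (\<beta> * real N)) + exp (- \<delta> * ?s))"
  proof (intro mult_left_mono)
    have "\<beta> * real N \<le> min (minabs (k + r) (?l g)) (minabs (k + r) (?l g'))"
      using assms minabs_lift_ge by (auto simp: E_def)
    then have "min (\<beta> * real N) ?s \<le> min (min (minabs (k + r) (?l g)) (minabs (k + r) (?l g'))) ?s"
      by linarith
    then have "exp (- \<delta> * min (min (minabs (k + r) (?l g)) (minabs (k + r) (?l g'))) ?s)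
        \<le> exp (- \<delta> * min (\<beta> * real N) ?s)"
      using \<delta> by simp
    also have "\<dots> \<le> exp (- \<delta> * (\<beta> * real N)) + exp (- \<delta> * ?s)"
      by (simp add: min_def)
    finally show "exp (- \<delta> * min (min (minabs (k + r) (?l g)) (minabs (k + r) (?l g'))) ?s) \<le> \<dots>" .
  qed (use C in auto)
  also have "exp (- \<delta> * (\<beta> * real N)) = (1 / 2 ^ N) ^ d"
  proof -
    have "\<delta> * (\<beta> * real N) = real (N * d) * ln 2" using \<delta> by (simp add: \<beta>_def)
    also have "exp (- \<dots>) = 1 / 2 ^ (N * d)"
      by (subst exp_minus, subst exp_of_nat_mult) (simp add: inverse_eq_divide)
    finally show ?thesis by (simp add: power_mult power_one_over)
  qed
  also have "exp (- \<delta> * ?s) \<le> exp (- (\<delta> / real d) * (\<Sum>i<d. \<bar>g i - g' i\<bar>))"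
    using mult_left_mono[OF supdist_lift_ge[of g g'], of \<delta>] \<delta> by simp
  finally show ?thesis using C by (simp add: mult_left_mono)
qed

text \<open>The correlation bound is integrated in its second point: its constant part meets a
  volume of at most \<open>(w * 2 ^ N) ^ d\<close> and the powers of two cancel, while its
  exponential part is integrable over the whole space. Hence \<open>\<kappa>\<close> is independent
  of \<open>N\<close>.\<close>

lemma E_second_moment:
  assumes D [measurable]: "D \<in> sets L" and sub: "D \<subseteq> E N (2 ^ N)"
  shows "(\<integral>x. (field.S D x)\<^sup>2 \<partial>M) \<le> \<kappa> * measure L D"
proof (rule field.second_moment_bound[OF D])
  have DJ: "emeasure L D \<le> emeasure L (J (2 ^ N))"
    using sub by (intro emeasure_mono) (auto simp: E_def)
  then show "emeasure L D < \<infinity>" using finite_emeasure_J by (rule order_le_less_trans)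
  show "0 \<le> \<kappa>" using C \<delta> w_ge_1 by (simp add: \<kappa>_def)
  fix g assume g: "g \<in> D"
  define e where "e g' = exp (- (\<delta> / real d) * (\<Sum>i<d. \<bar>g i - g' i\<bar>))" for g'
  have [measurable]: "e \<in> borel_measurable L"
    unfolding L_def e_def by measurable
  have "(\<integral>\<^sup>+g'. indicator D g' * ennreal \<bar>\<integral>x. G x g * G x g' \<partial>M\<bar> \<partial>L)
      \<le> (\<integral>\<^sup>+g'. ennreal (C * (1 / 2 ^ N) ^ d) * indicator D g' + ennreal C * ennreal (e g') \<partial>L)"
  proof (rule nn_integral_mono)
    fix g'
    show "indicator D g' * ennreal \<bar>\<integral>x. G x g * G x g' \<partial>M\<bar>
      \<le> ennreal (C * (1 / 2 ^ N) ^ d) * indicator D g' + ennreal C * ennreal (e g')"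
    proof (cases "g' \<in> D")
      case True
      have "ennreal \<bar>\<integral>x. G x g * G x g' \<partial>M\<bar> \<le> ennreal (C * (1 / 2 ^ N) ^ d + C * e g')"
        using correlation_bound[of g N "2 ^ N" g'] g True sub
        by (intro ennreal_leI) (auto simp: distrib_left e_def)
      also have "\<dots> = ennreal (C * (1 / 2 ^ N) ^ d) + ennreal C * ennreal (e g')"
        using C by (subst ennreal_plus) (auto simp: ennreal_mult e_def)
      finally show ?thesis using True by simp
    qed simp
  qed
  also have "\<dots> = ennreal (C * (1 / 2 ^ N) ^ d) * emeasure L D + ennreal C * (\<integral>\<^sup>+g'. ennreal (e g') \<partial>L)"
    by (simp add: nn_integral_add nn_integral_cmult nn_integral_cmult_indicator)
  also have "\<dots> \<le> ennreal (C * (1 / 2 ^ N) ^ d) * ennreal ((w * 2 ^ N) ^ d)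
      + ennreal C * ennreal ((2 / (\<delta> / real d)) ^ d)"
  proof (intro add_mono mult_left_mono)
    show "emeasure L D \<le> ennreal ((w * 2 ^ N) ^ d)"
      using DJ emeasure_J_le[of "2 ^ N"] by (auto intro: order_trans)
    show "(\<integral>\<^sup>+g'. ennreal (e g') \<partial>L) \<le> ennreal ((2 / (\<delta> / real d)) ^ d)"
      using nn_integral_PiM_exp_neg_l1[of "{..<d}" "\<delta> / real d" g] \<delta> d_pos by (simp add: L_def e_def)
  qed auto
  also have "\<dots> = ennreal \<kappa>"
  proof -
    have "C * (1 / 2 ^ N) ^ d * (w * 2 ^ N) ^ d = C * w ^ d"
      by (simp add: power_mult_distrib power_one_over)
    then show ?thesis
      using C \<delta> w_ge_1 by (simp add: \<kappa>_def distrib_left flip: ennreal_mult ennreal_plus)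
  qed
  finally show "(\<integral>\<^sup>+g'. indicator D g' * ennreal \<bar>\<integral>x. G x g * G x g' \<partial>M\<bar> \<partial>L) \<le> ennreal \<kappa>" .
qed

lemma E_sets: "E N j \<in> sets L" by (simp add: E_def)

lemma AE_E_bound:
  assumes \<epsilon>: "0 < \<epsilon>"
  shows "AE x in M. \<exists>c\<ge>0. \<forall>N. \<forall>j\<le>2 ^ N.
    \<bar>field.S (E N j) x - field.S (E N 0) x\<bar>
      \<le> c * sqrt ((w * 2 ^ N) ^ d) * (real N + 1) powr (3 / 2 + \<epsilon>)"
proof (rule field.AE_chaining_bound[OF E_sets])
  show "mono (E N)" for N
  proof (rule monoI)
    show "E N i \<subseteq> E N j" if "i \<le> j" for i j
      using J_mono[of "real i" "real j"] that by (auto simp: E_def)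
  qed
  show fin: "emeasure L (E N j) < \<infinity>" for N j
    by (rule finite_emeasure_subset_J) (auto simp: E_def)
  show "measure L (E N (2 ^ N)) \<le> (w * 2 ^ N) ^ d" for N
  proof -
    have "emeasure L (E N (2 ^ N)) \<le> emeasure L (J (2 ^ N))"
      by (intro emeasure_mono) (auto simp: E_def)
    also have "\<dots> \<le> ennreal ((w * 2 ^ N) ^ d)" by (intro emeasure_J_le) simp
    finally show ?thesis
      using w_ge_1 fin[of N "2 ^ N"] by (simp add: emeasure_eq_ennreal_measure)
  qed
  show "0 < (w * 2 ^ N) ^ d" for N using w_ge_1 by simp
  show "0 \<le> \<kappa>" using C \<delta> w_ge_1 by (simp add: \<kappa>_def)
  show "0 < \<epsilon>" by (rule \<epsilon>)
qed (rule E_second_moment)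

lemma S_le_of_emeasure_le:
  assumes "x \<in> space M" "D \<in> sets L" "emeasure L D \<le> ennreal v" "0 \<le> v"
  shows "\<bar>field.S D x\<bar> \<le> B * v"
proof -
  have fin: "emeasure L D < \<infinity>" using assms(3) by (simp add: order_le_less_trans)
  then have "measure L D \<le> v" using assms(3,4) by (simp add: emeasure_eq_ennreal_measure)
  then show ?thesis
    using field.S_bound[OF assms(1,2) fin] B by (meson mult_left_mono order_trans)
qed

text \<open>With \<open>j\<close> the integer part of \<open>T\<close> and \<open>N\<close> its
  dyadic scale, \<open>J T\<close> splits into \<open>E N j\<close>, the layer
  \<open>J j - bulk (\<beta> * N)\<close> and the shell \<open>J T - J j\<close>. Chaining handles
  the first; the other two are bounded by \<open>B\<close> times their volume.\<close>

lemma AE_J_bound: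
  assumes \<epsilon>: "0 < \<epsilon>"
  shows "AE x in M. \<exists>c\<ge>0. \<forall>T\<ge>2. \<bar>field.S (J T) x\<bar>
    \<le> c * (T powr (real d / 2) * ln T powr (3 / 2 + \<epsilon>) + T ^ (d - 1) * ln T)"
  using AE_E_bound[OF \<epsilon>] AE_space
proof eventually_elim
  case (elim x)
  then obtain c where c: "0 \<le> c" and bound: "\<And>N j. j \<le> 2 ^ N \<Longrightarrow>
    \<bar>field.S (E N j) x - field.S (E N 0) x\<bar>
      \<le> c * sqrt ((w * 2 ^ N) ^ d) * (real N + 1) powr (3 / 2 + \<epsilon>)" by blast
  have x: "x \<in> space M" using elim by simp
  \<comment> \<open>\<open>\<gamma>\<close> is \<open>B\<close> times the slab constant, with
    \<open>2 * w\<close> as a generous side length. The 2 in \<open>c1\<close> reflects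
    \<open>2 ^ N \<le> 2 * T\<close>, and both factors 6 come from
    \<open>real N + 1 \<le> 6 * ln T\<close>.\<close>
  define \<gamma> where "\<gamma> = B * (real (k + r) * real (n (r - 1)) * (2 * w) ^ (d - 1))"
  define c1 where "c1 = c * sqrt ((2 * w) ^ d) * 6 powr (3 / 2 + \<epsilon>)"
  define c2 where "c2 = \<gamma> * (\<beta> + 1) * 6"
  have \<gamma>: "0 \<le> \<gamma>" and \<beta>: "0 \<le> \<beta>" using B w_ge_1 \<delta> by (auto simp: \<gamma>_def \<beta>_def)
  have c12: "0 \<le> c1" "0 \<le> c2" using c \<gamma> \<beta> w_ge_1 by (auto simp: c1_def c2_def)
  have "\<bar>field.S (J T) x\<bar> \<le> (c1 + c2) * (T powr (real d / 2) * ln T powr (3 / 2 + \<epsilon>) + T ^ (d - 1) * ln T)"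
    if T: "2 \<le> T" for T
  proof -
    obtain N where N: "T \<le> 2 ^ N" "2 ^ N \<le> 2 * T" "real N + 1 \<le> 6 * ln T"
      using obtain_dyadic_scale[OF T] .
    define j where "j = nat \<lfloor>T\<rfloor>"
    have j: "real j \<le> T" "T \<le> real j + 1" using T by (auto simp: j_def)
    have "real j \<le> 2 ^ N" using j(1) N(1) by linarith
    then have j2: "j \<le> 2 ^ N" by (metis of_nat_le_iff of_nat_numeral of_nat_power)
    have wT: "(w * t) ^ (d - 1) \<le> (2 * w) ^ (d - 1) * T ^ (d - 1)" if "0 \<le> t" "t \<le> T" for t
      using that w_ge_1 T by (subst power_mult_distrib[symmetric]) (auto intro!: power_mono mult_mono)
    \<comment> \<open>Chaining bounds increments from index 0, and that starting set is null because
      \<open>d\<close> is positive.\<close>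
    have "emeasure L (E N 0) \<le> emeasure L (J 0)" by (intro emeasure_mono) (auto simp: E_def)
    also have "\<dots> \<le> 0" using emeasure_J_le[of 0] d_pos by (simp add: zero_power)
    finally have S0: "field.S (E N 0) x = 0"
      using S_le_of_emeasure_le[OF x E_sets, of N 0 0] by simp
    have "\<bar>field.S (E N j) x\<bar> \<le> c * sqrt ((w * 2 ^ N) ^ d) * (real N + 1) powr (3 / 2 + \<epsilon>)"
      using bound[OF j2] S0 by simp
    also have "\<dots> \<le> c * sqrt ((2 * w * T) ^ d) * (6 * ln T) powr (3 / 2 + \<epsilon>)"
    proof -
      have "w * 2 ^ N \<le> 2 * w * T" using mult_left_mono[OF N(2), of w] w_ge_1 by simp
      then have "sqrt ((w * 2 ^ N) ^ d) \<le> sqrt ((2 * w * T) ^ d)"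
        using w_ge_1 by (intro real_sqrt_le_mono power_mono) auto
      moreover have "(real N + 1) powr (3 / 2 + \<epsilon>) \<le> (6 * ln T) powr (3 / 2 + \<epsilon>)"
        using N(3) \<epsilon> by (intro powr_mono2) auto
      moreover have "0 \<le> sqrt ((2 * w * T) ^ d)" using w_ge_1 T by simp
      ultimately show ?thesis
        using c by (intro mult_mono mult_left_mono mult_nonneg_nonneg) auto
    qed
    also have "\<dots> = c1 * (T powr (real d / 2) * ln T powr (3 / 2 + \<epsilon>))"
    proof -
      have "sqrt (T ^ d) = T powr (real d / 2)"
        using T by (simp add: powr_half_sqrt[symmetric] powr_realpow[symmetric] powr_powr)
      moreover have "(6 * ln T) powr (3 / 2 + \<epsilon>) = 6 powr (3 / 2 + \<epsilon>) * ln T powr (3 / 2 + \<epsilon>)"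
        by (rule powr_mult)
      ultimately show ?thesis by (simp add: c1_def power_mult_distrib real_sqrt_mult mult_ac)
    qed
    finally have main: "\<bar>field.S (E N j) x\<bar> \<le> c1 * (T powr (real d / 2) * ln T powr (3 / 2 + \<epsilon>))" .
    have "\<bar>field.S (J j - bulk (\<beta> * N)) x\<bar>
        \<le> B * (real (k + r) * real (n (r - 1)) * (w * real j) ^ (d - 1) * (\<beta> * real N))"
      using \<beta> w_ge_1 by (intro S_le_of_emeasure_le[OF x] emeasure_J_minus_bulk_le) auto
    also have "\<dots> \<le> B * (real (k + r) * real (n (r - 1)) * ((2 * w) ^ (d - 1) * T ^ (d - 1)) * (\<beta> * real N))"
      using B \<beta> wT[OF _ j(1)] by (intro mult_left_mono mult_right_mono) auto
    also have "\<dots> = \<gamma> * T ^ (d - 1) * (\<beta> * real N)" by (simp add: \<gamma>_def mult_ac)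
    finally have bdry: "\<bar>field.S (J j - bulk (\<beta> * N)) x\<bar> \<le> \<gamma> * T ^ (d - 1) * (\<beta> * real N)" .
    have "\<bar>field.S (J T - J j) x\<bar>
        \<le> B * (real (k + r) * real (n (r - 1)) * (w * T) ^ (d - 1) * (T - real j))"
      using j T w_ge_1 by (intro S_le_of_emeasure_le[OF x] emeasure_J_minus_J_le) auto
    also have "\<dots> \<le> B * (real (k + r) * real (n (r - 1)) * ((2 * w) ^ (d - 1) * T ^ (d - 1)) * 1)"
      using B j T w_ge_1 wT[of T] by (intro mult_left_mono mult_mono) auto
    also have "\<dots> = \<gamma> * T ^ (d - 1) * 1" by (simp add: \<gamma>_def mult_ac)
    finally have slab: "\<bar>field.S (J T - J j) x\<bar> \<le> \<gamma> * T ^ (d - 1) * 1" .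
    have "field.S (J T - J j) x = field.S (J T) x - field.S (J j) x"
      using j by (intro field.S_diff[OF x] finite_emeasure_J J_mono) auto
    moreover have "field.S (J j - E N j) x = field.S (J j) x - field.S (E N j) x"
      by (intro field.S_diff[OF x] finite_emeasure_J E_sets) (auto simp: E_def)
    moreover have "J j - E N j = J j - bulk (\<beta> * N)" by (auto simp: E_def)
    ultimately have "\<bar>field.S (J T) x\<bar> \<le> c1 * (T powr (real d / 2) * ln T powr (3 / 2 + \<epsilon>))
        + \<gamma> * T ^ (d - 1) * (\<beta> * real N) + \<gamma> * T ^ (d - 1) * 1"
      using main bdry slab by simp
    also have "\<dots> = c1 * (T powr (real d / 2) * ln T powr (3 / 2 + \<epsilon>)) + \<gamma> * T ^ (d - 1) * (\<beta> * real N + 1)"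
      by (simp add: distrib_left)
    also have "\<gamma> * T ^ (d - 1) * (\<beta> * real N + 1) \<le> \<gamma> * T ^ (d - 1) * ((\<beta> + 1) * (6 * ln T))"
    proof (intro mult_left_mono)
      have "\<beta> * real N + 1 \<le> (\<beta> + 1) * (real N + 1)" using \<beta> by (simp add: algebra_simps)
      also have "\<dots> \<le> (\<beta> + 1) * (6 * ln T)" using \<beta> N(3) by (intro mult_left_mono) auto
      finally show "\<beta> * real N + 1 \<le> (\<beta> + 1) * (6 * ln T)" .
    qed (use \<gamma> T in auto)
    also have "\<dots> = c2 * (T ^ (d - 1) * ln T)" by (simp add: c2_def)
    also have "c1 * (T powr (real d / 2) * ln T powr (3 / 2 + \<epsilon>)) + c2 * (T ^ (d - 1) * ln T)
        \<le> (c1 + c2) * (T powr (real d / 2) * ln T powr (3 / 2 + \<epsilon>)) + (c1 + c2) * (T ^ (d - 1) * ln T)"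
      using c12 T by (intro add_mono mult_right_mono) auto
    finally show ?thesis by (simp add: distrib_left)
  qed
  then show ?case using c12 by (intro exI[of _ "c1 + c2"]) auto
qed

end

section \<open>Normalisation and comparison of growth rates\<close>

theorem theoremA1:
  fixes k r :: nat and m n :: "nat \<Rightarrow> nat"
    and M :: "'a measure" and F :: "'a \<Rightarrow> (nat \<Rightarrow> real) \<Rightarrow> real"
    and \<delta> C :: real
  assumes k: "k \<ge> 1" and r: "r \<ge> 1"
    and m_pos: "\<forall>i<k. m i > 0" and n_pos: "\<forall>j<r. n j > 0"
    and prob: "prob_space M"
    and F_meas: "(\<lambda>z. F (fst z) (snd z)) \<in> borel_measurable
          (restrict_space (M \<Otimes>\<^sub>M PiM {..<k + r} (\<lambda>_. lborel)) (space M \<times> orth (k + r)))"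
    and F_bdd: "\<exists>B. \<forall>x\<in>space M. \<forall>h\<in>orth (k + r). \<bar>F x h\<bar> \<le> B"
    and \<delta>: "\<delta> > 0" and C: "C > 0"
    and decay: "\<forall>h1\<in>hypR k r m n. \<forall>h2\<in>hypR k r m n.
          \<bar>integral\<^sup>L M (\<lambda>x. F x h1 * F x h2)\<bar>
            \<le> C * exp (- \<delta> * min (min (minabs (k + r) h1) (minabs (k + r) h2))
                                   (supdist (k + r) h1 h2))"
  shows "\<forall>\<epsilon>>0. AE y in M.
     (if k + r > 2 then
        (\<lambda>T. hyp_integral k r m n T (F y) / T ^ (k + r - 1))
          \<in> o[at_top](\<lambda>T. T powr (-1) * ln T powr (3/2 + real r + \<epsilon>))
      else
        (\<lambda>T. hyp_integral k r m n T (F y) / T ^ (k + r - 1))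
          \<in> o[at_top](\<lambda>T. T powr (-1/2) * ln T powr (3/2 + \<epsilon>)))"
proof (intro allI impI)
  fix \<epsilon> :: real assume \<epsilon>: "0 < \<epsilon>"
  obtain B where B: "\<forall>x\<in>space M. \<forall>h\<in>orth (k + r). \<bar>F x h\<bar> \<le> B" using F_bdd by blast
  interpret prob_space M by (rule prob)
  \<comment> \<open>The locale asks for a nonnegative bound, while the given \<open>B\<close> comes
    with no sign.\<close>
  interpret decorrelating_field k r m n M F "max 0 B" \<delta> C
  proof
    show "\<bar>F x h\<bar> \<le> max 0 B" if "x \<in> space M" "h \<in> orth (k + r)" for x h
      using B that by (simp add: le_max_iff_disj)
  qed (use k r m_pos n_pos F_meas \<delta> C decay in auto)
  \<comment> \<open>The pathwise bound is of big-O type; running it with half of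
    \<open>\<epsilon>\<close> leaves a logarithmic factor that turns it into little-o.\<close>
  have "0 < \<epsilon> / 2" using \<epsilon> by simp
  from AE_J_bound[OF this] show "AE y in M.
     (if k + r > 2 then
        (\<lambda>T. hyp_integral k r m n T (F y) / T ^ (k + r - 1))
          \<in> o[at_top](\<lambda>T. T powr (-1) * ln T powr (3/2 + real r + \<epsilon>))
      else
        (\<lambda>T. hyp_integral k r m n T (F y) / T ^ (k + r - 1))
          \<in> o[at_top](\<lambda>T. T powr (-1/2) * ln T powr (3/2 + \<epsilon>)))"
  proof eventually_elim
    case (elim y)
    then obtain c where c: "0 \<le> c" and bound: "\<And>T. 2 \<le> T \<Longrightarrow> \<bar>field.S (J T) y\<bar>
      \<le> c * (T powr (real d / 2) * ln T powr (3 / 2 + \<epsilon> / 2) + T ^ (d - 1) * ln T)" by blast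
    let ?f = "\<lambda>T. hyp_integral k r m n T (F y) / T ^ (k + r - 1)"
    have "norm (?f T) \<le> (\<bar>hyp_factor k r m n\<bar> * c) *
        norm (T powr (- (real d / 2)) * ln T powr (3 / 2 + \<epsilon> / 2) + T powr (-1) * ln T)"
      if T: "2 \<le> T" for T
    proof -
      have T1: "T powr (real d / 2) / T ^ d = T powr (- (real d / 2))"
      proof -
        have "T powr (real d / 2) / T ^ d = T powr (real d / 2 - real d)"
          using T by (subst powr_diff) (simp add: powr_realpow)
        then show ?thesis by simp
      qed
      have "T ^ d = T ^ (d - 1) * T" using d_pos by (cases d) auto
      then have T2: "T ^ (d - 1) / T ^ d = T powr (-1)"
        using T by (simp add: powr_minus field_simps)
      have "norm (?f T) = \<bar>hyp_factor k r m n\<bar> * (\<bar>field.S (J T) y\<bar> / T ^ d)"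
        using T by (simp add: hyp_integral_eq abs_mult d_def)
      also have "\<dots> \<le> \<bar>hyp_factor k r m n\<bar> *
          (c * (T powr (real d / 2) * ln T powr (3 / 2 + \<epsilon> / 2) + T ^ (d - 1) * ln T) / T ^ d)"
        using bound[OF T] T by (intro mult_left_mono divide_right_mono) auto
      also have "\<dots> = (\<bar>hyp_factor k r m n\<bar> * c) *
          ((T powr (real d / 2) / T ^ d) * ln T powr (3 / 2 + \<epsilon> / 2) + (T ^ (d - 1) / T ^ d) * ln T)"
        by (simp add: add_divide_distrib distrib_left)
      also have "\<dots> \<le> (\<bar>hyp_factor k r m n\<bar> * c) *
          norm (T powr (- (real d / 2)) * ln T powr (3 / 2 + \<epsilon> / 2) + T powr (-1) * ln T)"
        unfolding T1 T2 using c by (intro mult_left_mono) auto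
      finally show ?thesis .
    qed
    then have f: "?f \<in> O[at_top](\<lambda>T. T powr (- (real d / 2)) * ln T powr (3 / 2 + \<epsilon> / 2) + T powr (-1) * ln T)"
      by (intro bigoI[where c = "\<bar>hyp_factor k r m n\<bar> * c"] eventually_at_top_linorderI[of 2]) auto
    show ?case
    proof (cases "k + r > 2")
      case True
      then have d: "2 \<le> d" by (simp add: d_def)
      \<comment> \<open>For \<open>d\<close> at least 2 the chaining term decays at least like
        \<open>T powr (-1)\<close> up to logarithms, as does the boundary term; both logarithmic
        exponents lie below \<open>3 / 2 + real r + \<epsilon>\<close>.\<close>
      have "(\<lambda>T. T powr (- (real d / 2)) * ln T powr (3 / 2 + \<epsilon> / 2))
          \<in> O[at_top](\<lambda>T. T powr (-1) * ln T powr (3 / 2 + \<epsilon> / 2))"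
      proof (intro bigoI[where c = 1] eventually_at_top_linorderI[of 1])
        fix T :: real assume "1 \<le> T"
        then have "T powr (- (real d / 2)) \<le> T powr (-1)" using d by (intro powr_mono) auto
        then have "T powr (- (real d / 2)) * ln T powr (3 / 2 + \<epsilon> / 2)
            \<le> T powr (-1) * ln T powr (3 / 2 + \<epsilon> / 2)" by (intro mult_right_mono) auto
        then show "norm (T powr (- (real d / 2)) * ln T powr (3 / 2 + \<epsilon> / 2))
            \<le> 1 * norm (T powr (-1) * ln T powr (3 / 2 + \<epsilon> / 2))" by (simp only: real_norm_def mult_1 mult_nonneg_nonneg powr_ge_zero abs_of_nonneg)
      qed
      also have "(\<lambda>T::real. T powr (-1) * ln T powr (3 / 2 + \<epsilon> / 2))
          \<in> o[at_top](\<lambda>T. T powr (-1) * ln T powr (3 / 2 + real r + \<epsilon>))"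
        using \<epsilon> by (intro powr_ln_smallo) simp
      finally have 1: "(\<lambda>T. T powr (- (real d / 2)) * ln T powr (3 / 2 + \<epsilon> / 2))
          \<in> o[at_top](\<lambda>T. T powr (-1) * ln T powr (3 / 2 + real r + \<epsilon>))" .
      \<comment> \<open>Writing \<open>ln T\<close> as a real power brings the boundary term under
        the same comparison; the two agree once \<open>T\<close> is at least 1.\<close>
      have "(\<lambda>T::real. T powr (-1) * ln T powr 1)
          \<in> o[at_top](\<lambda>T. T powr (-1) * ln T powr (3 / 2 + real r + \<epsilon>))"
        using \<epsilon> by (intro powr_ln_smallo) simp
      moreover have "eventually (\<lambda>T::real. T powr (-1) * ln T powr 1 = T powr (-1) * ln T) at_top"
        by (intro eventually_at_top_linorderI[of 1]) simp
      ultimately have 2: "(\<lambda>T::real. T powr (-1) * ln T)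
          \<in> o[at_top](\<lambda>T. T powr (-1) * ln T powr (3 / 2 + real r + \<epsilon>))"
        by (subst (asm) landau_o.small.in_cong)
      show ?thesis
        using True landau_o.big_small_trans[OF f sum_in_smallo(1)[OF 1 2]] by simp
    next
      case False
      then have d: "d = 1" using k r by (simp add: d_def)
      \<comment> \<open>For \<open>d = 1\<close> the chaining term already has the claimed power of
        \<open>T\<close> and gains only through the logarithm; the boundary term is smaller by a
        power of \<open>T\<close>.\<close>
      have 1: "(\<lambda>T. T powr (- (real d / 2)) * ln T powr (3 / 2 + \<epsilon> / 2))
          \<in> o[at_top](\<lambda>T. T powr (-1/2) * ln T powr (3 / 2 + \<epsilon>))"
        unfolding d using powr_ln_smallo[of "3 / 2 + \<epsilon> / 2" "3 / 2 + \<epsilon>" "-1/2"] \<epsilon> by simp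
      have 2: "(\<lambda>T::real. T powr (-1) * ln T) \<in> o[at_top](\<lambda>T. T powr (-1/2) * ln T powr (3 / 2 + \<epsilon>))"
        using \<epsilon> by (intro inverse_ln_smallo_sqrt) simp
      show ?thesis
        using False landau_o.big_small_trans[OF f sum_in_smallo(1)[OF 1 2]] by simp
    qed
  qed
qed

end
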